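(* The linear endomorphism of $\hat{\mathcal{B}}^n$ defined on the basis $\{[(\mathbf{S})]\}$ (over standard ordered set partitions $\mathbf{S}$ of $\{1,\ldots,n\}$) by $$[(\mathbf{S})]\mapsto [(S_1,\mathbf{S}_{i_1})]\bullet\cdots\bullet[(S_1,\mathbf{S}_{i_m})],\quad\text{where }\mathcal{U}_{\mathcal{B}}(\mathbf{S})=\{(S_1,\mathbf{S}_{i_1}),\ldots,(S_1,\mathbf{S}_{i_m})\},$$ is invertible. Consequently the set of functions $[(T,\mathbf{S}_1)]\bullet\cdots\bullet[(T,\mathbf{S}_\ell)]$, as $\{(T,\mathbf{S}_1),\ldots,(T,\mathbf{S}_\ell)\}$ ranges over all 2-standard composite ordered set partitions of $\{1,\ldots,n\}$, is linearly independent (and hence a basis of $\hat{\mathcal{B}}^n$).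
   Context: $V_0^n=\{x\in\mathbb{R}^n:\sum_ix_i=0\}$, $x_S=\sum_{i\in S}x_i$. For $C\subseteq V_0^n$, $[C]$ is its characteristic function; $\bullet$ is convolution, the unique bilinear product on the span of characteristic functions of closed polyhedral cones in $V_0^n$ with $[C_1]\bullet[C_2]=[C_1\oplus C_2]$. An ordered set partition (OSP) of $U$ is a sequence of nonempty pairwise disjoint blocks with union $U$; standard if the first block contains $\min U$; 2-standard if $(S_1,S_2,\ldots,S_k)$ is standard and $(S_2,\ldots,S_k)$ is a standard OSP of $U\setminus S_1$. For an OSP $(V_1,\ldots,V_a)$ of $U\subseteq\{1,\ldots,n\}$ the plate is $[V_1,\ldots,V_a]=\{x\in V_0^n:x_i=0\ (i\notin U),\ x_{V_1\cup\cdots\cup V_j}\ge0,\ j<a\}$ with characteristic function $[[V_1,\ldots,V_a]]$, and the graduated blade function is $[(V_1,\ldots,V_a)]=\sum_{j=1}^a[[V_j,\ldots,V_a,V_1,\ldots,V_{j-1}]]$. $\hat{\mathcal{B}}^n$ is the complex span of all $[(\mathbf{S})]$, $\mathbf{S}$ a standard OSP of $\{1,\ldots,n\}$ (these are linearly independent). A 2-standard composite OSP of $\{1,\ldots,n\}$ is a set $\{(T,\mathbf{S}_1),\ldots,(T,\mathbf{S}_\ell)\}$ where $T\ni 1$, $T,U_1,\ldots,U_\ell$ partition $\{1,\ldots,n\}$, $\mathbf{S}_i$ is an OSP of $U_i$, $(T,\mathbf{S}_i)$ (block $T$ followed by the blocks of $\mathbf{S}_i$) is 2-standard; for $\ell=0$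 (so $T=\{1,\ldots,n\}$) the associated function is $[(\{1,\ldots,n\})]$. The bijection $\mathcal{U}_{\mathcal{B}}$: for a standard OSP $\mathbf{S}=(S_1,\ldots,S_k)$ of $\{1,\ldots,n\}$ with $k=1$ set $\mathcal{U}_{\mathcal{B}}(\mathbf{S})=\{(S_1)\}$; for $k\ge2$ let $i_0=k+1$ and recursively let $i_p$ be the index $j\in\{2,\ldots,i_{p-1}-1\}$ such that $S_j$ contains $\min(S_2\cup\cdots\cup S_{i_{p-1}-1})$, stopping when $i_m=2$; put $\mathbf{S}_{i_p}=(S_{i_p},S_{i_p+1},\ldots,S_{i_{p-1}-1})$ and $\mathcal{U}_{\mathcal{B}}(\mathbf{S})=\{(S_1,\mathbf{S}_{i_1}),\ldots,(S_1,\mathbf{S}_{i_m})\}$. (E.g. $\mathcal{U}_{\mathcal{B}}(1,5,4,3,2)=\{(1,2),(1,3),(1,4),(1,5)\}$.) *)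

theory Defs
  imports Complex_Main
    "HOL-Library.Function_Algebras"
    "HOL-Library.Set_Algebras"
    "HOL-Library.Indicator_Function"
    "HOL-Library.Disjoint_Sets"
begin

text \<open>A vector of \<open>\<real>\<^sup>n\<close> is a function \<open>nat \<Rightarrow> real\<close> that vanishes off \<open>{1..n}\<close>, and a
  function on \<open>V0 n\<close> is extended by zero to all of \<open>nat \<Rightarrow> real\<close>.\<close>

type_synonym vec = "nat \<Rightarrow> real"
type_synonym cfun = "vec \<Rightarrow> complex"

definition cscale :: "complex \<Rightarrow> ('a \<Rightarrow> complex) \<Rightarrow> 'a \<Rightarrow> complex" where
  "cscale c f = (\<lambda>x. c * f x)"

global_interpretation cfun: vector_space "cscale :: complex \<Rightarrow> ('a \<Rightarrow> complex) \<Rightarrow> 'a \<Rightarrow> complex"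
  by unfold_locales (simp_all add: cscale_def plus_fun_def fun_eq_iff algebra_simps)

definition V0 :: "nat \<Rightarrow> vec set" where
  "V0 n = {x. (\<forall>i. i \<notin> {1..n} \<longrightarrow> x i = 0) \<and> (\<Sum>i=1..n. x i) = 0}"

abbreviation char_fun :: "vec set \<Rightarrow> cfun" where
  "char_fun C \<equiv> indicator C"


subsection \<open>Convolution\<close>

definition polyhedral_cone :: "nat \<Rightarrow> vec set \<Rightarrow> bool" where
  "polyhedral_cone n C \<longleftrightarrow>
     (\<exists>A :: vec set. finite A \<and> C = {x \<in> V0 n. \<forall>a\<in>A. 0 \<le> (\<Sum>i=1..n. a i * x i)})"

definition cone_span :: "nat \<Rightarrow> cfun set" where
  "cone_span n = cfun.span {char_fun C |C. polyhedral_cone n C}"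

text \<open>The last clause only fixes the value of the operation outside its domain, so that
  the product is unique as a total function. \<open>C + D\<close> is the Minkowski sum.\<close>

definition is_convolution :: "nat \<Rightarrow> (cfun \<Rightarrow> cfun \<Rightarrow> cfun) \<Rightarrow> bool" where
  "is_convolution n p \<longleftrightarrow>
     (\<forall>f\<in>cone_span n. \<forall>g\<in>cone_span n. p f g \<in> cone_span n) \<and>
     (\<forall>f\<in>cone_span n. \<forall>g\<in>cone_span n. \<forall>h\<in>cone_span n. p (f + g) h = p f h + p g h) \<and>
     (\<forall>f\<in>cone_span n. \<forall>g\<in>cone_span n. \<forall>h\<in>cone_span n. p f (g + h) = p f g + p f h) \<and>
     (\<forall>c. \<forall>f\<in>cone_span n. \<forall>g\<in>cone_span n. p (cscale c f) g = cscale c (p f g)) \<and>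
     (\<forall>c. \<forall>f\<in>cone_span n. \<forall>g\<in>cone_span n. p f (cscale c g) = cscale c (p f g)) \<and>
     (\<forall>C D. polyhedral_cone n C \<longrightarrow> polyhedral_cone n D \<longrightarrow>
        p (char_fun C) (char_fun D) = char_fun (C + D)) \<and>
     (\<forall>f g. f \<notin> cone_span n \<or> g \<notin> cone_span n \<longrightarrow> p f g = 0)"

definition conv :: "nat \<Rightarrow> cfun \<Rightarrow> cfun \<Rightarrow> cfun" where
  "conv n = (THE p. is_convolution n p)"


subsection \<open>Ordered set partitions, plates and graduated blades\<close>

definition osp :: "nat set \<Rightarrow> nat set list \<Rightarrow> bool" where
  "osp U S \<longleftrightarrow> distinct S \<and> partition_on U (set S)"

definition standard_osp :: "nat set \<Rightarrow> nat set list \<Rightarrow> bool" where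
  "standard_osp U S \<longleftrightarrow> osp U S \<and> S \<noteq> [] \<and> Min U \<in> hd S"

definition two_standard_osp :: "nat set \<Rightarrow> nat set list \<Rightarrow> bool" where
  "two_standard_osp U S \<longleftrightarrow>
     standard_osp U S \<and> (tl S = [] \<or> standard_osp (U - hd S) (tl S))"

definition plate :: "nat \<Rightarrow> nat set list \<Rightarrow> vec set" where
  "plate n V = {x \<in> V0 n. (\<forall>i. i \<notin> \<Union>(set V) \<longrightarrow> x i = 0) \<and>
     (\<forall>j\<in>{1..<length V}. 0 \<le> (\<Sum>i\<in>\<Union>(set (take j V)). x i))}"

definition blade :: "nat \<Rightarrow> nat set list \<Rightarrow> cfun" where
  "blade n V = (\<Sum>j<length V. char_fun (plate n (rotate j V)))"

definition blade_space :: "nat \<Rightarrow> cfun set" where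
  "blade_space n = cfun.span {blade n S |S. standard_osp {1..n} S}"


subsection \<open>Composite ordered set partitions\<close>

text \<open>For \<open>\<ell> = 0\<close> the composite is \<open>{(T)}\<close> with \<open>T = {1..n}\<close>, which is also the value of
  \<open>U_B\<close> on the one-block partition; its function is then \<open>[({1..n})]\<close>.\<close>

definition composite_osp :: "nat \<Rightarrow> nat set list set \<Rightarrow> bool" where
  "composite_osp n C \<longleftrightarrow>
     (\<exists>T Ss. 1 \<in> T \<and>
        osp {1..n} (T # map (\<lambda>S. \<Union>(set S)) Ss) \<and>
        (\<forall>S\<in>set Ss. osp (\<Union>(set S)) S \<and> two_standard_osp (T \<union> \<Union>(set S)) (T # S)) \<and>
        C = (if Ss = [] then {[T]} else (\<lambda>S. T # S) ` set Ss))"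

text \<open>The start value \<open>[{0}]\<close> of the fold is the neutral element of the convolution.\<close>

definition composite_fun :: "nat \<Rightarrow> nat set list set \<Rightarrow> cfun" where
  "composite_fun n C = Finite_Set.fold (\<lambda>S f. conv n (blade n S) f) (char_fun {0}) C"

text \<open>Blocks and cut indices are numbered from 1: \<open>block S j\<close> is \<open>S\<^sub>j\<close> and \<open>cut_index S p\<close> is \<open>i\<^sub>p\<close>.\<close>

definition block :: "nat set list \<Rightarrow> nat \<Rightarrow> nat set" where
  "block S j = S ! (j - 1)"

primrec cut_index :: "nat set list \<Rightarrow> nat \<Rightarrow> nat" where
  "cut_index S 0 = length S + 1"
| "cut_index S (Suc p) =
     (THE j. j \<in> {2..<cut_index S p} \<and> Min (\<Union>l\<in>{2..<cut_index S p}. block S l) \<in> block S j)"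

definition cut_count :: "nat set list \<Rightarrow> nat" where
  "cut_count S = (LEAST m. cut_index S m = 2)"

definition U_B :: "nat set list \<Rightarrow> nat set list set" where
  "U_B S = (if length S = 1 then {S}
     else {block S 1 # map (block S) [cut_index S p..<cut_index S (p - 1)] |p. p \<in> {1..cut_count S}})"

definition linear_endo_on :: "cfun set \<Rightarrow> (cfun \<Rightarrow> cfun) \<Rightarrow> bool" where
  "linear_endo_on W \<phi> \<longleftrightarrow>
     (\<forall>f\<in>W. \<phi> f \<in> W) \<and>
     (\<forall>f\<in>W. \<forall>g\<in>W. \<phi> (f + g) = \<phi> f + \<phi> g) \<and>
     (\<forall>c. \<forall>f\<in>W. \<phi> (cscale c f) = cscale c (\<phi> f))"

definition U_B_endo :: "nat \<Rightarrow> (cfun \<Rightarrow> cfun) \<Rightarrow> bool" where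
  "U_B_endo n \<phi> \<longleftrightarrow> linear_endo_on (blade_space n) \<phi> \<and>
     (\<forall>S. standard_osp {1..n} S \<longrightarrow> \<phi> (blade n S) = composite_fun n (U_B S))"

end

theory Submission
  imports Defs "HOL-Library.List_Lexorder"
begin

text \<open>
  Projecting polyhedra along one coordinate preserves linear relations between their indicator
  functions, because the fibres are closed intervals and the Euler characteristic of a nonempty closed
  interval is 1. As a Minkowski sum is a projection, the convolution exists.

  On a plate \<open>[V, T, U]\<close> the conditions say that all prefix sums over \<open>V\<close> are nonnegative and all
  suffix sums over \<open>U\<close> are nonpositive, so \<open>T\<close> does not enter. Hence \<open>[(T, A)] \<bullet> [(T, B)]\<close> is a
  pointwise product of a function of the block sums over \<open>A\<close> with one of those over \<open>B\<close>, and it equals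
  the sum of \<open>[(T, C)]\<close> over the quasi-shuffles \<open>C\<close> of \<open>A\<close> and \<open>B\<close>, signed by the number of merged
  blocks. If the pieces of \<open>U_B S\<close> are multiplied in this way, then \<open>S\<close> itself occurs with coefficient 1
  and every other term has a lexicographically smaller word of block minima: the endomorphism is
  unitriangular.

  The blades are linearly independent since plates are. Convolution with a half-space turns a relation
  between cones into a relation between their polars, and the polar of a plate is a face of the braid
  fan, so that a longest plate in a relation is separated from the others.
\<close>

section \<open>Relations between polyhedra under projection\<close>

text \<open>\<open>conv\<close> is a definite description, so nothing can be computed before linear
  relations among indicators are known to survive Minkowski addition. Closedness is the point: the
  indicator of [0,1] is the sum of those of [0,1) and {1}, yet projecting the line to a point would
  turn this into 1 = 1 + 1. Polyhedra remain closed under projection, which general closed convex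
  sets do not.

  The sign of a merge comes from [a + b \<le> 0] ([a \<le> 0] + [b \<le> 0] - 1) = [a \<le> 0]
  [b \<le> 0], which makes sign conditions on partial sums multiplicative for quasi-shuffles.

  Triangularity has to survive multiplication by further pieces. The pieces have decreasing minima
  from left to right, so the first block of the product of the later pieces has a smaller minimum
  than every block of the piece before them; moving it forward or merging it lowers the word at
  once, and this remains true for the lower terms.\<close>

lemma closed_intervals_relation:
  fixes I :: "'i set" and P :: "'i \<Rightarrow> real set" and c :: "'i \<Rightarrow> complex"
  assumes fin: "finite I" and cl: "\<And>i. i \<in> I \<Longrightarrow> closed (P i)"
    and conv: "\<And>i a b. i \<in> I \<Longrightarrow> a \<in> P i \<Longrightarrow> b \<in> P i \<Longrightarrow> {a..b} \<subseteq> P i"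
    and zero: "\<And>t. (\<Sum>i\<in>I. c i * of_bool (t \<in> P i)) = 0"
  shows "(\<Sum>i\<in>I. c i * of_bool (P i \<noteq> {})) = 0"
proof -
  \<comment> \<open>\<open>mx i t\<close> says that \<open>t\<close> is the maximum of
    \<open>P i\<close>. A nonempty closed interval either has a maximum or contains all large reals,
    never both; the two kinds are counted separately.\<close>
  define mx where "mx i t \<longleftrightarrow> t \<in> P i \<and> (\<forall>s\<in>P i. s \<le> t)" for i t
  have right: "\<forall>\<^sub>F s in at_right t. s \<in> P i \<longleftrightarrow> t \<in> P i \<and> \<not> mx i t" if "i \<in> I" for i t
  proof -
    consider "t \<notin> P i" | "mx i t" | u where "t \<in> P i" "u \<in> P i" "t < u" "\<not> mx i t"
      unfolding mx_def by force
    then show ?thesis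
    proof cases
      case 1
      have "\<forall>\<^sub>F s in nhds t. s \<in> - P i"
        using cl[OF that] 1 by (intro eventually_nhds_in_open) auto
      then have "\<forall>\<^sub>F s in at_right t. s \<in> - P i"
        by (simp add: eventually_at_filter eventually_mono)
      then show ?thesis by eventually_elim (use 1 in auto)
    next
      case 2
      have "\<forall>\<^sub>F s in at_right t. t < s" by (rule eventually_at_right_less)
      then show ?thesis by eventually_elim (use 2 mx_def in force)
    next
      case 3
      have "\<forall>\<^sub>F s in at_right t. s \<in> {t<..<u}"
        using 3 by (intro eventually_at_right_real) auto
      then show ?thesis by eventually_elim (use 3 conv[OF that, of t u] in force)
    qed
  qed
  \<comment> \<open>On passing from \<open>t\<close> to a point \<open>s\<close> just right of it,
    an interval containing \<open>t\<close> is lost exactly if \<open>t\<close> is its maximum.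
    Since \<open>I\<close> is finite, one \<open>s\<close> serves all intervals.\<close>
  have mx0: "(\<Sum>i\<in>I. c i * of_bool (mx i t)) = 0" for t
  proof -
    have "\<forall>\<^sub>F s in at_right t. \<forall>i\<in>I. s \<in> P i \<longleftrightarrow> t \<in> P i \<and> \<not> mx i t"
      using right fin by (simp add: eventually_ball_finite)
    then obtain s where s: "\<forall>i\<in>I. s \<in> P i \<longleftrightarrow> t \<in> P i \<and> \<not> mx i t"
      using eventually_happens trivial_limit_at_right_real by blast
    have "(\<Sum>i\<in>I. c i * of_bool (mx i t))
        = (\<Sum>i\<in>I. c i * of_bool (t \<in> P i)) - (\<Sum>i\<in>I. c i * of_bool (s \<in> P i))"
      unfolding sum_subtractf[symmetric] by (intro sum.cong) (use s in \<open>auto simp: mx_def\<close>)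
    then show ?thesis using zero by simp
  qed
  have top: "\<forall>\<^sub>F s in at_top. s \<in> P i \<longleftrightarrow> P i \<noteq> {} \<and> (\<nexists>t. mx i t)" if "i \<in> I" for i
  proof -
    consider "P i = {}" | t where "mx i t" | a where "a \<in> P i" "\<nexists>t. mx i t" by blast
    then show ?thesis
    proof cases
      case 2
      have "\<forall>\<^sub>F s in at_top. t < s" by (rule eventually_gt_at_top)
      then show ?thesis by eventually_elim (use 2 in \<open>auto simp: mx_def dest: leD\<close>)
    next
      case 3
      \<comment> \<open>A bounded closed interval contains its supremum, which would be a
        maximum.\<close>
      have "\<not> bdd_above (P i)"
      proof
        assume bdd: "bdd_above (P i)"
        have "Sup (P i) \<in> - P i" using 3(2) bdd unfolding mx_def by (auto intro: cSup_upper)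
        then obtain b where b: "b < Sup (P i)" "{b<..Sup (P i)} \<subseteq> - P i"
          using open_left[of "- P i" "Sup (P i)" "Sup (P i) - 1"] cl[OF \<open>i \<in> I\<close>] by auto
        then show False using less_cSupD[of "P i" b] 3(1) cSup_upper[OF _ bdd] by force
      qed
      then have "\<exists>b\<in>P i. s < b" for s unfolding bdd_above_def by (meson not_le)
      then have "s \<in> P i" if "a \<le> s" for s
        using conv[OF \<open>i \<in> I\<close> 3(1)] that by (meson atLeastAtMost_iff less_imp_le subsetD)
      then show ?thesis
        by (intro eventually_mono[OF eventually_ge_at_top[of a]]) (use 3 in blast)
    qed simp
  qed
  have "\<forall>\<^sub>F s in at_top. \<forall>i\<in>I. s \<in> P i \<longleftrightarrow> P i \<noteq> {} \<and> (\<nexists>t. mx i t)"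
    using top fin by (simp add: eventually_ball_finite)
  then obtain s where s: "\<forall>i\<in>I. s \<in> P i \<longleftrightarrow> P i \<noteq> {} \<and> (\<nexists>t. mx i t)"
    using eventually_happens'[OF trivial_limit_at_top_linorder] by blast
  have uniq: "t = u" if "mx i t" "mx i u" for i t u
    using that unfolding mx_def by force
  \<comment> \<open>Finitely many points carry all maxima; summing \<open>mx0\<close> over them
    counts each interval with a maximum exactly once.\<close>
  define B where "B = (\<Union>i\<in>I. {t. mx i t})"
  have "finite {t. mx i t}" for i
    by (cases "\<exists>t. mx i t") (auto intro: finite_subset[of _ "{THE t. mx i t}"] simp: uniq the_equality)
  then have finB: "finite B" using fin by (simp add: B_def)
  have "(\<Sum>t\<in>B. of_bool (mx i t)) = (of_bool (\<exists>t. mx i t) :: complex)" if "i \<in> I" for i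
  proof (cases "\<exists>t. mx i t")
    case True
    then obtain t where t: "mx i t" by blast
    then have "(\<Sum>u\<in>B. of_bool (mx i u)) = (\<Sum>u\<in>{t}. of_bool (mx i u) :: complex)"
      using that finB uniq by (intro sum.mono_neutral_right) (auto simp: B_def)
    with t True show ?thesis by simp
  qed auto
  then have "(\<Sum>i\<in>I. c i * of_bool (\<exists>t. mx i t)) = (\<Sum>i\<in>I. \<Sum>t\<in>B. c i * of_bool (mx i t))"
    by (simp add: sum_distrib_left[symmetric])
  also have "\<dots> = 0" by (subst sum.swap) (simp add: mx0)
  finally have "(\<Sum>i\<in>I. c i * of_bool (\<exists>t. mx i t)) = 0" .
  moreover have "(\<Sum>i\<in>I. c i * of_bool (P i \<noteq> {}))
      = (\<Sum>i\<in>I. c i * of_bool (\<exists>t. mx i t)) + (\<Sum>i\<in>I. c i * of_bool (s \<in> P i))"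
    unfolding sum.distrib[symmetric] by (intro sum.cong) (use s in \<open>auto simp: mx_def\<close>)
  ultimately show ?thesis using zero by simp
qed

section \<open>Fourier-Motzkin elimination\<close>

definition halfspaces :: "nat set \<Rightarrow> vec set \<Rightarrow> vec set" where
  "halfspaces J A = {z. \<forall>a\<in>A. 0 \<le> (\<Sum>i\<in>J. a i * z i)}"

definition proj :: "nat set \<Rightarrow> vec set \<Rightarrow> vec set" where
  "proj K P = {z. \<exists>w\<in>P. \<forall>i. i \<notin> K \<longrightarrow> w i = z i}"

text \<open>With the positive multipliers \<open>a k\<close> for \<open>b\<close> and
  \<open>- b k\<close> for \<open>a\<close>, the combined constraint has coefficient 0 at the
  eliminated coordinate \<open>k\<close>.\<close>

definition fm_elim :: "nat \<Rightarrow> vec set \<Rightarrow> vec set" where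
  "fm_elim k A = {a \<in> A. a k = 0} \<union>
     (\<lambda>(a, b) i. a k * b i - b k * a i) ` ({a \<in> A. 0 < a k} \<times> {b \<in> A. b k < 0})"

lemma ex_between_finite:
  fixes L U :: "real set"
  assumes "finite L" "finite U" "\<And>l u. l \<in> L \<Longrightarrow> u \<in> U \<Longrightarrow> l \<le> u"
  shows "\<exists>t. (\<forall>l\<in>L. l \<le> t) \<and> (\<forall>u\<in>U. t \<le> u)"
proof (cases "L = {}")
  case True
  show ?thesis
  proof (cases "U = {}")
    case False
    then show ?thesis using True assms(2) by (intro exI[of _ "Min U"]) auto
  qed (use True in auto)
next
  case False
  then show ?thesis using assms by (intro exI[of _ "Max L"]) (auto simp: Max_ge)
qed

lemma proj_single: "proj {k} P = {z. \<exists>t. z(k := t) \<in> P}"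
proof -
  have "w = z(k := w k)" if "\<forall>i. i \<noteq> k \<longrightarrow> w i = z i" for w z :: vec
    using that by (auto simp: fun_eq_iff)
  then have "(\<exists>w\<in>P. \<forall>i. i \<noteq> k \<longrightarrow> w i = z i) \<longleftrightarrow> (\<exists>t. z(k := t) \<in> P)" for z
    by (metis fun_upd_other)
  then show ?thesis by (simp add: proj_def)
qed

lemma halfspaces_fun_upd:
  assumes "finite J" "k \<in> J"
  shows "(z :: vec)(k := t) \<in> halfspaces J A
    \<longleftrightarrow> (\<forall>a\<in>A. 0 \<le> a k * t + (\<Sum>i\<in>J - {k}. a i * z i))"
proof -
  have "(\<Sum>i\<in>J. a i * (z(k := t)) i) = a k * t + (\<Sum>i\<in>J - {k}. a i * z i)" for a
    using assms by (subst sum.remove[of _ k]) (auto intro!: sum.cong)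
  then show ?thesis by (simp add: halfspaces_def)
qed

lemma proj_halfspaces_single:
  assumes "finite J" "k \<in> J" "finite A"
  shows "proj {k} (halfspaces J A) = halfspaces J (fm_elim k A)"
proof (intro set_eqI)
  fix z :: vec
  define \<beta> :: "vec \<Rightarrow> real" where "\<beta> a = (\<Sum>i\<in>J - {k}. a i * z i)" for a
  have split: "(\<Sum>i\<in>J. a i * z i) = a k * z k + \<beta> a" for a
    unfolding \<beta>_def using assms by (subst sum.remove[of _ k]) auto
  have comb: "(\<Sum>i\<in>J. (a k * b i - b k * a i) * z i) = a k * \<beta> b - b k * \<beta> a" for a b :: vec
  proof -
    have "(\<Sum>i\<in>J. (a k * b i - b k * a i) * z i)
        = a k * (\<Sum>i\<in>J. b i * z i) - b k * (\<Sum>i\<in>J. a i * z i)"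
      by (simp add: sum_distrib_left sum_subtractf algebra_simps)
    then show ?thesis by (simp add: split algebra_simps)
  qed
  have R: "z \<in> halfspaces J (fm_elim k A) \<longleftrightarrow> (\<forall>a\<in>A. a k = 0 \<longrightarrow> 0 \<le> \<beta> a) \<and>
      (\<forall>a\<in>A. \<forall>b\<in>A. 0 < a k \<longrightarrow> b k < 0 \<longrightarrow> 0 \<le> a k * \<beta> b - b k * \<beta> a)"
    unfolding halfspaces_def fm_elim_def by (auto simp: comb split ball_Un)
  have L: "z \<in> proj {k} (halfspaces J A) \<longleftrightarrow> (\<exists>t. \<forall>a\<in>A. 0 \<le> a k * t + \<beta> a)"
    by (simp add: proj_single halfspaces_fun_upd[OF assms(1,2)] \<beta>_def)
  show "z \<in> proj {k} (halfspaces J A) \<longleftrightarrow> z \<in> halfspaces J (fm_elim k A)"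
    unfolding L R
  proof (intro iffI conjI ballI impI)
    assume "\<exists>t. \<forall>a\<in>A. 0 \<le> a k * t + \<beta> a"
    then obtain t where t: "\<And>a. a \<in> A \<Longrightarrow> 0 \<le> a k * t + \<beta> a" by blast
    { fix a assume "a \<in> A" "a k = 0" then show "0 \<le> \<beta> a" using t[of a] by simp }
    fix a b assume ab: "a \<in> A" "b \<in> A" "0 < a k" "b k < 0"
    have "0 \<le> a k * (b k * t + \<beta> b) + (- b k) * (a k * t + \<beta> a)"
      using t[OF ab(1)] t[OF ab(2)] ab(3,4)
      by (intro add_nonneg_nonneg[OF mult_nonneg_nonneg mult_nonneg_nonneg]) auto
    then show "0 \<le> a k * \<beta> b - b k * \<beta> a" by (simp add: algebra_simps)
  next
    assume r: "(\<forall>a\<in>A. a k = 0 \<longrightarrow> 0 \<le> \<beta> a) \<and>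
      (\<forall>a\<in>A. \<forall>b\<in>A. 0 < a k \<longrightarrow> b k < 0 \<longrightarrow> 0 \<le> a k * \<beta> b - b k * \<beta> a)"
    \<comment> \<open>Solved for \<open>t\<close>, a constraint with \<open>a k > 0\<close> is a
      lower bound and one with \<open>a k < 0\<close> an upper bound; the eliminated constraints say
      that each such pair is compatible.\<close>
    have "\<exists>t. (\<forall>l\<in>(\<lambda>a. - \<beta> a / a k) ` {a\<in>A. 0 < a k}. l \<le> t) \<and>
              (\<forall>u\<in>(\<lambda>a. - \<beta> a / a k) ` {a\<in>A. a k < 0}. t \<le> u)"
    proof (rule ex_between_finite)
      fix l u assume "l \<in> (\<lambda>a. - \<beta> a / a k) ` {a\<in>A. 0 < a k}"
        "u \<in> (\<lambda>a. - \<beta> a / a k) ` {a\<in>A. a k < 0}"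
      then obtain a b where ab: "a \<in> A" "0 < a k" "l = - \<beta> a / a k"
        "b \<in> A" "b k < 0" "u = - \<beta> b / b k" by blast
      then have "0 \<le> a k * \<beta> b - b k * \<beta> a" using r by blast
      then show "l \<le> u" unfolding ab(3,6) using ab(2,5)
        by (simp add: pos_divide_le_eq divide_simps) (simp add: algebra_simps)
    qed (use assms in auto)
    then obtain t where t: "\<And>a. a \<in> A \<Longrightarrow> 0 < a k \<Longrightarrow> - \<beta> a / a k \<le> t"
      "\<And>a. a \<in> A \<Longrightarrow> a k < 0 \<Longrightarrow> t \<le> - \<beta> a / a k" by auto
    have "0 \<le> a k * t + \<beta> a" if "a \<in> A" for a
    proof (cases "a k" "0::real" rule: linorder_cases)
      case less
      then show ?thesis using t(2)[OF that less] neg_le_divide_eq[OF less, of t "- \<beta> a"]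
        by (simp add: mult.commute)
    next
      case equal
      then show ?thesis using r that by simp
    next
      case greater
      then show ?thesis using t(1)[OF that greater] pos_divide_le_eq[OF greater, of "- \<beta> a" t]
        by (simp add: mult.commute)
    qed
    then show "\<exists>t. \<forall>a\<in>A. 0 \<le> a k * t + \<beta> a" by blast
  qed
qed

lemma finite_fm_elim: "finite A \<Longrightarrow> finite (fm_elim k A)"
  by (simp add: fm_elim_def)

lemma proj_empty: "proj {} P = P"
  proof -
  have "(\<forall>i. w i = z i) \<longleftrightarrow> w = z" for w z :: vec by (simp add: fun_eq_iff)
  then show ?thesis by (simp add: proj_def)
qed

lemma proj_insert: "proj (insert k K) P = proj {k} (proj K P)"
proof (intro set_eqI iffI)
  fix z assume "z \<in> proj (insert k K) P"
  then obtain w where w: "w \<in> P" "\<And>i. i \<notin> insert k K \<Longrightarrow> w i = z i" by (auto simp: proj_def)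
  then have "z(k := w k) \<in> proj K P" by (auto simp: proj_def intro!: bexI[of _ w])
  then show "z \<in> proj {k} (proj K P)" by (auto simp: proj_single)
next
  fix z assume "z \<in> proj {k} (proj K P)"
  then show "z \<in> proj (insert k K) P" unfolding proj_def by (auto; metis)
qed

lemma proj_halfspaces:
  assumes "finite K" "finite J" "K \<subseteq> J" "finite A"
  shows "\<exists>B. finite B \<and> proj K (halfspaces J A) = halfspaces J B"
  using assms
proof (induction K rule: finite_induct)
  case empty
  then show ?case by (auto simp: proj_empty)
next
  case (insert k K)
  then obtain B where "finite B" "proj K (halfspaces J A) = halfspaces J B" by auto
  with insert.prems show ?case
    by (intro exI[of _ "fm_elim k B"]) (simp add: proj_insert[of k K] proj_halfspaces_single finite_fm_elim)
qed

text \<open>Coordinates are removed one at a time. Elimination keeps each projected set a finite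
  intersection of closed half-spaces, so its fibre along the next coordinate is a closed
  interval.\<close>

lemma proj_relation:
  fixes c :: "'i \<Rightarrow> complex"
  assumes "finite K" "finite J" "K \<subseteq> J" "finite I"
    and P: "\<And>i. i \<in> I \<Longrightarrow> \<exists>A. finite A \<and> P i = halfspaces J A"
    and zero: "\<And>z. (\<Sum>i\<in>I. c i * of_bool (z \<in> P i)) = 0"
  shows "(\<Sum>i\<in>I. c i * of_bool (z \<in> proj K (P i))) = 0"
  using assms(1,3)
proof (induction K arbitrary: z rule: finite_induct)
  case empty
  then show ?case using zero by (simp add: proj_empty)
next
  case (insert k K)
  define R where "R i = {t. z(k := t) \<in> proj K (P i)}" for i
  have k: "k \<in> J" using insert.prems by simp
  have "(\<Sum>i\<in>I. c i * of_bool (R i \<noteq> {})) = 0"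
  proof (rule closed_intervals_relation[OF assms(4)])
    fix i assume "i \<in> I"
    then obtain B where B: "finite B" "proj K (P i) = halfspaces J B"
      using P proj_halfspaces[OF insert.hyps(1) assms(2)] insert.prems by (metis insert_subset)
    have R: "R i = (\<Inter>a\<in>B. {t. 0 \<le> a k * t + (\<Sum>i\<in>J - {k}. a i * z i)})"
      unfolding R_def B(2) halfspaces_fun_upd[OF assms(2) k] by auto
    show "closed (R i)" unfolding R
      by (intro closed_INT ballI closed_Collect_le continuous_intros)
    fix a b assume ab: "a \<in> R i" "b \<in> R i"
    have between: "0 \<le> s * t + r" if "0 \<le> s * a + r" "0 \<le> s * b + r" "a \<le> t" "t \<le> b" for s r t
    proof (cases "0 \<le> s")
      case True
      then show ?thesis using that mult_left_mono[of a t s] by linarith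
    next
      case False
      then show ?thesis using that mult_left_mono_neg[of t b s] by linarith
    qed
    show "{a..b} \<subseteq> R i"
    proof
      fix t assume "t \<in> {a..b}"
      then have t: "a \<le> t" "t \<le> b" by simp_all
      show "t \<in> R i" unfolding R
      proof (intro INT_I CollectI)
        fix f assume "f \<in> B"
        then show "0 \<le> f k * t + (\<Sum>i\<in>J - {k}. f i * z i)"
          using ab unfolding R by (intro between[OF _ _ t]) blast+
      qed
    qed
  next
    fix t show "(\<Sum>i\<in>I. c i * of_bool (t \<in> R i)) = 0"
      using insert.IH insert.prems by (simp add: R_def)
  qed
  moreover have "z \<in> proj (insert k K) (P i) \<longleftrightarrow> R i \<noteq> {}" for i
    by (auto simp: proj_insert[of k K] proj_single R_def)
  ultimately show ?case by simp
qed

section \<open>Convolution\<close>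

interpretation cfun_pair: vector_space_pair
  "cscale :: complex \<Rightarrow> cfun \<Rightarrow> cfun" "cscale :: complex \<Rightarrow> cfun \<Rightarrow> cfun"
  ..

text \<open>The map is extended from a maximal independent subset \<open>B\<close> of the
  generators; the hypothesis on relations forces the remaining generators to go where they
  should.\<close>

lemma linear_extension_if_relations:
  fixes h :: "cfun \<Rightarrow> cfun"
  assumes rel: "\<And>t c. finite t \<Longrightarrow> t \<subseteq> G \<Longrightarrow> (\<Sum>g\<in>t. cscale (c g) g) = 0
    \<Longrightarrow> (\<Sum>g\<in>t. cscale (c g) (h g)) = 0"
  shows "\<exists>L. Vector_Spaces.linear cscale cscale L \<and> (\<forall>g\<in>G. L g = h g)"
proof -
  obtain B where B: "B \<subseteq> G" "cfun.independent B" "G \<subseteq> cfun.span B"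
    using cfun.maximal_independent_subset by blast
  obtain L where L: "Vector_Spaces.linear cscale cscale L" "\<And>b. b \<in> B \<Longrightarrow> L b = h b"
    using cfun_pair.linear_independent_extend[OF B(2)] by blast
  interpret L: Vector_Spaces.linear cscale cscale L by fact
  have "L g = h g" if g: "g \<in> G" for g
  proof (cases "g \<in> B")
    case False
    obtain t r where t: "finite t" "t \<subseteq> B" "g = (\<Sum>b\<in>t. cscale (r b) b)"
      using B(3) g unfolding cfun.span_explicit by auto
    have gt: "g \<notin> t" using t False by blast
    \<comment> \<open>Coefficient -1 at \<open>g\<close> turns the expansion of \<open>g\<close>
      over \<open>t\<close> into a relation.\<close>
    have upd: "(\<Sum>b\<in>t. cscale ((r(g := -1)) b) (k b)) = (\<Sum>b\<in>t. cscale (r b) (k b))" for k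
      by (intro sum.cong) (use gt in auto)
    have "(\<Sum>b\<in>insert g t. cscale ((r(g := -1)) b) b) = 0"
      using t gt upd[of "\<lambda>b. b"] by (simp add: cfun.scale_minus_left)
    then have "(\<Sum>b\<in>insert g t. cscale ((r(g := -1)) b) (h b)) = 0"
      using rel t B(1) g by blast
    then have "h g = (\<Sum>b\<in>t. cscale (r b) (h b))"
      using t(1) gt upd[of h] by (simp add: cfun.scale_minus_left)
    also have "\<dots> = (\<Sum>b\<in>t. cscale (r b) (L b))"
      using L(2) t(2) by (intro sum.cong) auto
    also have "\<dots> = L g" by (simp only: t(3) L.sum L.scale)
    finally show ?thesis by simp
  qed (use L in auto)
  with L(1) show ?thesis by blast
qed

section \<open>Minkowski sums as projections\<close>

definition low_part :: "nat \<Rightarrow> vec \<Rightarrow> vec" where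
  "low_part n z i = (if i \<in> {1..n} then z i else 0)"

text \<open>A vector on \<open>{1..2*n}\<close> stores a pair: its first half is the summand that is
  projected away, its second half the total.\<close>

definition high_part :: "nat \<Rightarrow> vec \<Rightarrow> vec" where
  "high_part n z i = (if i \<in> {1..n} then z (n + i) else 0)"

lemma sum_double: "(\<Sum>i=1..2*n. f i) = (\<Sum>i=1..n. f i) + (\<Sum>i=1..n. f (n + i))"
  for f :: "nat \<Rightarrow> real"
proof -
  have "(\<Sum>i=1..n+n. f i) = (\<Sum>i=1..n. f i) + (\<Sum>i=n+1..n+n. f i)"
    by (rule sum.ub_add_nat) simp
  also have "(\<Sum>i=n+1..n+n. f i) = (\<Sum>i=1..n. f (n + i))"
    using sum.shift_bounds_cl_nat_ivl[of f 1 n n] by (simp add: add.commute)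
  finally show ?thesis by (simp add: mult_2)
qed

lemma polyhedral_cone_halfspaces:
  assumes "polyhedral_cone n C"
  obtains A where "finite A"
    "C = {x. (\<forall>i. i \<notin> {1..n} \<longrightarrow> x i = 0) \<and> (\<forall>a\<in>A. 0 \<le> (\<Sum>i=1..n. a i * x i))}"
proof -
  obtain A where A: "finite A" "C = {x \<in> V0 n. \<forall>a\<in>A. 0 \<le> (\<Sum>i=1..n. a i * x i)}"
    using assms unfolding polyhedral_cone_def by blast
  \<comment> \<open>The equation of \<open>V0 n\<close> becomes two opposite inequalities, so that
    only inequalities and the support condition remain.\<close>
  have "(\<Sum>i=1..n. x i) = 0 \<longleftrightarrow> 0 \<le> (\<Sum>i=1..n. 1 * x i) \<and> 0 \<le> (\<Sum>i=1..n. - 1 * x i)" for x :: vec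
    by (auto simp: sum_negf)
  then show thesis using A
    by (intro that[of "insert (\<lambda>_. 1) (insert (\<lambda>_. - 1) A)"]) (auto simp: V0_def)
qed

lemma low_part_cone_halfspaces:
  assumes "polyhedral_cone n C"
  obtains A where "finite A" "\<And>z. z \<in> halfspaces {1..2*n} A \<longleftrightarrow> low_part n z \<in> C"
proof -
  obtain A where A: "finite A"
    "C = {x. (\<forall>i. i \<notin> {1..n} \<longrightarrow> x i = 0) \<and> (\<forall>a\<in>A. 0 \<le> (\<Sum>i=1..n. a i * x i))}"
    using polyhedral_cone_halfspaces[OF assms] .
  define e where "e a = (\<lambda>i. if i \<in> {1..n} then a i else 0)" for a :: vec
  have "(\<Sum>i=1..2*n. e a i * z i) = (\<Sum>i=1..n. a i * low_part n z i)" for a z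
  proof -
    have "(\<Sum>i=1..n. e a i * z i) = (\<Sum>i=1..n. a i * low_part n z i)"
      by (intro sum.cong) (auto simp: e_def low_part_def)
    moreover have "(\<Sum>i=1..n. e a (n + i) * z (n + i)) = 0"
      by (intro sum.neutral) (auto simp: e_def)
    ultimately show ?thesis unfolding sum_double by simp
  qed
  then show thesis using A
    by (intro that[of "e ` A"]) (auto simp: halfspaces_def low_part_def)
qed

lemma diff_part_cone_halfspaces:
  assumes "polyhedral_cone n D"
  obtains A where "finite A" "\<And>z. z \<in> halfspaces {1..2*n} A \<longleftrightarrow> high_part n z - low_part n z \<in> D"
proof -
  obtain A where A: "finite A"
    "D = {x. (\<forall>i. i \<notin> {1..n} \<longrightarrow> x i = 0) \<and> (\<forall>a\<in>A. 0 \<le> (\<Sum>i=1..n. a i * x i))}"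
    using polyhedral_cone_halfspaces[OF assms] .
  \<comment> \<open>The functional \<open>a\<close> pulled back along the difference of the two
    halves.\<close>
  define e where "e a = (\<lambda>i. if i \<in> {1..n} then - a i else a (i - n))" for a :: vec
  have "(\<Sum>i=1..2*n. e a i * z i) = (\<Sum>i=1..n. a i * (high_part n z - low_part n z) i)" for a z
  proof -
    have "(\<Sum>i=1..2*n. e a i * z i) = (\<Sum>i=1..n. e a i * z i + e a (n + i) * z (n + i))"
      unfolding sum_double sum.distrib ..
    also have "\<dots> = (\<Sum>i=1..n. a i * (high_part n z - low_part n z) i)"
      by (intro sum.cong) (auto simp: e_def low_part_def high_part_def algebra_simps)
    finally show ?thesis .
  qed
  then show thesis using A
    by (intro that[of "e ` A"]) (auto simp: halfspaces_def low_part_def high_part_def)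
qed

text \<open>The pair \<open>(0, x)\<close>. The zeros are placeholders, as only membership in a
  projection along \<open>{1..n}\<close> is asked.\<close>

definition shift_up :: "nat \<Rightarrow> vec \<Rightarrow> vec" where
  "shift_up n x i = (if i \<in> {n+1..2*n} then x (i - n) else 0)"

lemma polyhedral_cone_support: "polyhedral_cone n C \<Longrightarrow> x \<in> C \<Longrightarrow> x \<in> V0 n"
  by (auto simp: polyhedral_cone_def)

lemma V0_add: "x \<in> V0 n \<Longrightarrow> y \<in> V0 n \<Longrightarrow> x + y \<in> V0 n"
  by (auto simp: V0_def sum.distrib)

lemma V0_diff: "x \<in> V0 n \<Longrightarrow> y \<in> V0 n \<Longrightarrow> x - y \<in> V0 n"
  by (auto simp: V0_def sum_subtractf)

text \<open>The Minkowski sum is a coordinate projection of \<open>{(y, x). y \<in> C \<and> x - y \<in> D}\<close>.\<close>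

lemma minkowski_sum_proj:
  assumes C: "polyhedral_cone n C" and D: "polyhedral_cone n D"
  obtains A where "finite A"
    "\<And>z. z \<in> halfspaces {1..2*n} A \<longleftrightarrow> low_part n z \<in> C \<and> high_part n z - low_part n z \<in> D"
    "\<And>x. x \<in> V0 n \<Longrightarrow> x \<in> C + D \<longleftrightarrow> shift_up n x \<in> proj {1..n} (halfspaces {1..2*n} A)"
proof -
  obtain A1 where A1: "finite A1" "\<And>z. z \<in> halfspaces {1..2*n} A1 \<longleftrightarrow> low_part n z \<in> C"
    using low_part_cone_halfspaces[OF C] by blast
  obtain A2 where A2: "finite A2"
      "\<And>z. z \<in> halfspaces {1..2*n} A2 \<longleftrightarrow> high_part n z - low_part n z \<in> D"
    using diff_part_cone_halfspaces[OF D] by blast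
  have A: "z \<in> halfspaces {1..2*n} (A1 \<union> A2)
      \<longleftrightarrow> low_part n z \<in> C \<and> high_part n z - low_part n z \<in> D" for z
    using A1(2)[of z] A2(2)[of z] by (auto simp: halfspaces_def)
  have "x \<in> C + D \<longleftrightarrow> shift_up n x \<in> proj {1..n} (halfspaces {1..2*n} (A1 \<union> A2))" if x: "x \<in> V0 n" for x
  proof
    assume "x \<in> C + D"
    then obtain y d where yd: "y \<in> C" "d \<in> D" "x = y + d" by (auto elim: set_plus_elim)
    have y: "y \<in> V0 n" using polyhedral_cone_support[OF C] yd by blast
    define w where "w = (\<lambda>i. if i \<in> {1..n} then y i else shift_up n x i)"
    have "low_part n w = y" using y by (auto simp: low_part_def w_def V0_def fun_eq_iff)
    moreover have "high_part n w = x" using x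
      by (auto simp: high_part_def w_def V0_def fun_eq_iff shift_up_def)
    ultimately have "w \<in> halfspaces {1..2*n} (A1 \<union> A2)" unfolding A using yd by simp
    then show "shift_up n x \<in> proj {1..n} (halfspaces {1..2*n} (A1 \<union> A2))"
      unfolding proj_def by (auto simp: w_def intro!: bexI[of _ w])
  next
    assume "shift_up n x \<in> proj {1..n} (halfspaces {1..2*n} (A1 \<union> A2))"
    then obtain w where w: "w \<in> halfspaces {1..2*n} (A1 \<union> A2)"
      "\<And>i. i \<notin> {1..n} \<Longrightarrow> w i = shift_up n x i" by (auto simp: proj_def)
    have "high_part n w = x" using x w(2)
      by (auto simp: high_part_def V0_def fun_eq_iff shift_up_def)
    then have "low_part n w \<in> C" "x - low_part n w \<in> D" using w(1) unfolding A by auto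
    then have "low_part n w + (x - low_part n w) \<in> C + D" by (rule set_plus_intro)
    then show "x \<in> C + D" by simp
  qed
  with A A1(1) A2(1) show thesis by (intro that[of "A1 \<union> A2"]) auto
qed

lemma polyhedral_cone_plus:
  assumes C: "polyhedral_cone n C" and D: "polyhedral_cone n D"
  shows "polyhedral_cone n (C + D)"
proof -
  obtain A where A: "finite A"
    "\<And>z. z \<in> halfspaces {1..2*n} A \<longleftrightarrow> low_part n z \<in> C \<and> high_part n z - low_part n z \<in> D"
    "\<And>x. x \<in> V0 n \<Longrightarrow> x \<in> C + D \<longleftrightarrow> shift_up n x \<in> proj {1..n} (halfspaces {1..2*n} A)"
    by (rule minkowski_sum_proj[OF C D]) blast
  obtain B where B: "finite B" "proj {1..n} (halfspaces {1..2*n} A) = halfspaces {1..2*n} B"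
    using proj_halfspaces[of "{1..n}" "{1..2*n}" A] A(1) by auto
  \<comment> \<open>A constraint on \<open>shift_up n x\<close> sees only its coefficients at
    \<open>n + i\<close>; these become the constraints that describe \<open>C + D\<close>.\<close>
  have sum: "(\<Sum>i=1..2*n. b i * shift_up n x i) = (\<Sum>i=1..n. b (n + i) * x i)" for b x
    unfolding sum_double by (auto simp: shift_up_def)
  have sub: "x \<in> V0 n" if "x \<in> C + D" for x
    using that polyhedral_cone_support[OF C] polyhedral_cone_support[OF D]
    by (auto elim!: set_plus_elim intro: V0_add)
  define Q where "Q x \<longleftrightarrow> (\<forall>b\<in>(\<lambda>b i. b (n + i)) ` B. 0 \<le> (\<Sum>i=1..n. b i * x i))" for x
  have "x \<in> C + D \<longleftrightarrow> Q x" if "x \<in> V0 n" for x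
    unfolding A(3)[OF that] B(2) Q_def unfolding halfspaces_def mem_Collect_eq sum by simp
  with sub have "C + D = {x \<in> V0 n. Q x}" by blast
  with B(1) show ?thesis unfolding polyhedral_cone_def Q_def
    by (intro exI[of _ "(\<lambda>b i. b (n + i)) ` B"]) simp
qed

text \<open>Evaluated at the first half of a pair and restricted to pairs whose difference lies in
  \<open>D\<close>, the relation becomes one between polyhedra on \<open>2*n\<close> coordinates,
  and projection yields the claim.\<close>

lemma minkowski_sum_relation:
  fixes c :: "vec set \<Rightarrow> complex"
  assumes T: "finite T" "\<And>C. C \<in> T \<Longrightarrow> polyhedral_cone n C" and D: "polyhedral_cone n D"
    and zero: "\<And>x. (\<Sum>C\<in>T. c C * indicator C x) = 0"
  shows "(\<Sum>C\<in>T. c C * indicator (C + D) x) = 0"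
proof (cases "x \<in> V0 n")
  case True
  have "\<forall>C\<in>T. \<exists>A. finite A \<and>
    (\<forall>z. z \<in> halfspaces {1..2*n} A \<longleftrightarrow> low_part n z \<in> C \<and> high_part n z - low_part n z \<in> D) \<and>
    (\<forall>x. x \<in> V0 n \<longrightarrow> x \<in> C + D \<longleftrightarrow> shift_up n x \<in> proj {1..n} (halfspaces {1..2*n} A))"
  proof
    fix C assume "C \<in> T"
    show "\<exists>A. finite A \<and>
      (\<forall>z. z \<in> halfspaces {1..2*n} A \<longleftrightarrow> low_part n z \<in> C \<and> high_part n z - low_part n z \<in> D) \<and>
      (\<forall>x. x \<in> V0 n \<longrightarrow> x \<in> C + D \<longleftrightarrow> shift_up n x \<in> proj {1..n} (halfspaces {1..2*n} A))"
      by (rule minkowski_sum_proj[OF T(2)[OF \<open>C \<in> T\<close>] D]) blast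
  qed
  then obtain A where A: "\<And>C. C \<in> T \<Longrightarrow> finite (A C)"
    "\<And>C z. C \<in> T \<Longrightarrow> z \<in> halfspaces {1..2*n} (A C) \<longleftrightarrow> low_part n z \<in> C \<and> high_part n z - low_part n z \<in> D"
    "\<And>C x. C \<in> T \<Longrightarrow> x \<in> V0 n \<Longrightarrow>
       x \<in> C + D \<longleftrightarrow> shift_up n x \<in> proj {1..n} (halfspaces {1..2*n} (A C))"
    by metis
  have "(\<Sum>C\<in>T. c C * of_bool (shift_up n x \<in> proj {1..n} (halfspaces {1..2*n} (A C)))) = 0"
  proof (rule proj_relation[where J = "{1..2*n}"])
    fix z
    have "(\<Sum>C\<in>T. c C * of_bool (z \<in> halfspaces {1..2*n} (A C)))
       = of_bool (high_part n z - low_part n z \<in> D) * (\<Sum>C\<in>T. c C * indicator C (low_part n z))"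
      unfolding sum_distrib_left by (intro sum.cong) (use A(2) in \<open>auto simp: indicator_def simp del: One_nat_def\<close>)
    then show "(\<Sum>C\<in>T. c C * of_bool (z \<in> halfspaces {1..2*n} (A C))) = 0" by (simp add: zero)
  qed (use T A in auto)
  moreover have "(\<Sum>C\<in>T. c C * of_bool (shift_up n x \<in> proj {1..n} (halfspaces {1..2*n} (A C))))
     = (\<Sum>C\<in>T. c C * indicator (C + D) x)"
    by (intro sum.cong) (use A(3)[OF _ True] in \<open>auto simp: indicator_def\<close>)
  ultimately show ?thesis by simp
next
  case False
  then have "x \<notin> C + D" if "C \<in> T" for C
    using polyhedral_cone_support[OF polyhedral_cone_plus[OF T(2)[OF that] D]] by blast
  then show ?thesis by (simp add: sum.neutral)
qed

lemma indicator_cfun_eq_iff: "(indicator C :: cfun) = indicator D \<longleftrightarrow> C = D"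
  by (auto simp: fun_eq_iff indicator_def split: if_splits)

lemma sum_fun_apply: "(\<Sum>i\<in>I. f i) x = (\<Sum>i\<in>I. f i x)"
  by (induction I rule: infinite_finite_induct) auto

lemma sum_cscale_apply: "(\<Sum>i\<in>I. cscale (c i) (f i)) x = (\<Sum>i\<in>I. c i * f i x)"
  by (simp add: sum_fun_apply cscale_def)

lemma minkowski_sum_linear:
  assumes D: "polyhedral_cone n D"
  shows "\<exists>L. Vector_Spaces.linear cscale cscale L \<and>
    (\<forall>C. polyhedral_cone n C \<longrightarrow> L (char_fun C) = char_fun (C + D))"
proof -
  \<comment> \<open>The extension criterion wants a map on functions, so the cone is recovered from
    its indicator as the level set at 1.\<close>
  define h :: "cfun \<Rightarrow> cfun" where "h f = indicator ({x. f x = 1} + D)" for f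
  have h: "h (indicator C) = indicator (C + D)" for C
  proof -
    have "{x. indicator C x = (1::complex)} = C" by (auto simp: indicator_def)
    then show ?thesis by (simp add: h_def)
  qed
  have "\<exists>L. Vector_Spaces.linear cscale cscale L \<and> (\<forall>g\<in>{char_fun C |C. polyhedral_cone n C}. L g = h g)"
  proof (rule linear_extension_if_relations)
    fix t :: "cfun set" and c
    assume t: "finite t" "t \<subseteq> {char_fun C |C. polyhedral_cone n C}" "(\<Sum>g\<in>t. cscale (c g) g) = 0"
    define T where "T = {C. polyhedral_cone n C \<and> char_fun C \<in> t}"
    have inj: "inj_on char_fun T" by (auto simp: inj_on_def indicator_cfun_eq_iff)
    have t_eq: "t = char_fun ` T" using t(2) by (auto simp: T_def)
    have finT: "finite T" using t(1) inj t_eq finite_imageD by blast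
    have sumT: "(\<Sum>g\<in>t. cscale (c g) (k g)) x = (\<Sum>C\<in>T. c (char_fun C) * k (char_fun C) x)" for k x
      unfolding sum_cscale_apply t_eq by (simp add: sum.reindex[OF inj])
    have "(\<Sum>C\<in>T. c (char_fun C) * indicator C x) = 0" for x
      using sumT[of "\<lambda>g. g" x] t(3) by simp
    then have "(\<Sum>C\<in>T. c (char_fun C) * indicator (C + D) x) = 0" for x
      by (intro minkowski_sum_relation[OF finT _ D]) (auto simp: T_def)
    then show "(\<Sum>g\<in>t. cscale (c g) (h g)) = 0" by (simp add: fun_eq_iff sumT h)
  qed
  then obtain L where L: "Vector_Spaces.linear cscale cscale L"
    "\<And>C. polyhedral_cone n C \<Longrightarrow> L (char_fun C) = h (char_fun C)" by blast
  then show ?thesis using h by (intro exI[of _ L]) simp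
qed

section \<open>The bilinear extension of the Minkowski sum\<close>

lemma cone_span_add: "f \<in> cone_span n \<Longrightarrow> g \<in> cone_span n \<Longrightarrow> f + g \<in> cone_span n"
  by (simp add: cone_span_def cfun.span_add)

lemma cone_span_scale: "f \<in> cone_span n \<Longrightarrow> cscale c f \<in> cone_span n"
  by (simp add: cone_span_def cfun.span_scale)

lemma cone_span_zero: "0 \<in> cone_span n"
  by (simp add: cone_span_def cfun.span_zero)

lemma cone_span_char: "polyhedral_cone n C \<Longrightarrow> char_fun C \<in> cone_span n"
  by (auto simp: cone_span_def intro: cfun.span_base)

text \<open>Higher-order unification against \<open>P 0\<close> and \<open>P (f + g)\<close> eta-expands \<open>0\<close> and \<open>f + g\<close>, so the
  pointwise simp rules would fire where only linearity is wanted.\<close>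

context
  notes zero_fun_apply [simp del] plus_fun_apply [simp del]
begin

lemma cone_span_induct [consumes 1, case_names zero add scale cone]:
  assumes "f \<in> cone_span n" "P 0"
    "\<And>f g. f \<in> cone_span n \<Longrightarrow> g \<in> cone_span n \<Longrightarrow> P f \<Longrightarrow> P g \<Longrightarrow> P (f + g)"
    "\<And>c f. f \<in> cone_span n \<Longrightarrow> P f \<Longrightarrow> P (cscale c f)"
    "\<And>C. polyhedral_cone n C \<Longrightarrow> P (char_fun C)"
  shows "P f"
proof -
  have "f \<in> cone_span n \<and> P f"
    using assms(1)[unfolded cone_span_def]
  proof (rule cfun.span_induct_alt)
    show "0 \<in> cone_span n \<and> P 0" using assms(2) cone_span_zero by blast
    fix c x y
    assume "x \<in> {char_fun C |C. polyhedral_cone n C}" and y: "y \<in> cone_span n \<and> P y"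
    then obtain C where C: "x = char_fun C" "polyhedral_cone n C" by blast
    then have x: "x \<in> cone_span n" "P x" using cone_span_char assms(5) by auto
    then show "cscale c x + y \<in> cone_span n \<and> P (cscale c x + y)"
      using y assms(3)[of "cscale c x" y] assms(4) cone_span_scale[OF x(1)] cone_span_add by blast
  qed
  then show ?thesis by blast
qed

text \<open>The extension is done in two stages: \<open>L D\<close> is linear in the first factor
  for a fixed cone \<open>D\<close>, and for fixed \<open>f\<close> the values \<open>L D f\<close>
  are then extended linearly in the second factor to \<open>M f\<close>.\<close>

lemma ex_convolution: "\<exists>p. is_convolution n p"
proof -
  obtain L where L: "\<And>D. polyhedral_cone n D \<Longrightarrow> Vector_Spaces.linear cscale cscale (L D)"
    "\<And>C D. polyhedral_cone n D \<Longrightarrow> polyhedral_cone n C \<Longrightarrow> L D (char_fun C) = char_fun (C + D)"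
    using minkowski_sum_linear by metis
  have Ladd: "L D (f + g) = L D f + L D g" if "polyhedral_cone n D" for D f g
    using L(1)[OF that] by (simp add: Vector_Spaces.linear_iff)
  have Lscale: "L D (cscale c f) = cscale c (L D f)" if "polyhedral_cone n D" for D f c
    using L(1)[OF that] by (simp add: Vector_Spaces.linear_iff)
  have L0: "L D 0 = 0" if "polyhedral_cone n D" for D
    using Lscale[OF that, of 0 0] by simp
  have plus: "char_fun (C + D) \<in> cone_span n" if "polyhedral_cone n C" "polyhedral_cone n D" for C D
    using that by (intro cone_span_char polyhedral_cone_plus)
  have Lspan: "L D f \<in> cone_span n" if "polyhedral_cone n D" "f \<in> cone_span n" for D f
    using that(2)
    by (rule cone_span_induct)
      (auto simp: L0 Ladd Lscale L(2) that(1) cone_span_zero plus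
        intro: cone_span_add cone_span_scale)
  \<comment> \<open>Sums and multiples of such extensions are again extensions, so it suffices to
    treat the indicator of a cone; there commutativity of the Minkowski sum leads back to the first
    stage.\<close>
  have "\<exists>M. Vector_Spaces.linear cscale cscale M \<and> (\<forall>D. polyhedral_cone n D \<longrightarrow> M (char_fun D) = L D f)"
    if f: "f \<in> cone_span n" for f
    using f
  proof (induction rule: cone_span_induct)
    case zero
    show ?case using L0 cfun_pair.linear_zero by (intro exI[of _ "\<lambda>_. 0"]) simp
  next
    case (add f g)
    then obtain M N where "Vector_Spaces.linear cscale cscale M" "Vector_Spaces.linear cscale cscale N"
      "\<And>D. polyhedral_cone n D \<Longrightarrow> M (char_fun D) = L D f"
      "\<And>D. polyhedral_cone n D \<Longrightarrow> N (char_fun D) = L D g" by blast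
    then show ?case
      by (intro exI[of _ "\<lambda>x. M x + N x"]) (auto simp: Ladd Vector_Spaces.linear_iff cfun.scale_right_distrib)
  next
    case (scale c f)
    then obtain M where "Vector_Spaces.linear cscale cscale M"
      "\<And>D. polyhedral_cone n D \<Longrightarrow> M (char_fun D) = L D f" by blast
    then show ?case
      by (intro exI[of _ "\<lambda>x. cscale c (M x)"])
        (auto simp: Lscale Vector_Spaces.linear_iff cfun.scale_right_distrib mult.commute)
  next
    case (cone C)
    then show ?case using minkowski_sum_linear[OF cone] L(2) by (simp add: add.commute)
  qed
  then obtain M where M: "\<And>f. f \<in> cone_span n \<Longrightarrow> Vector_Spaces.linear cscale cscale (M f)"
    "\<And>f D. f \<in> cone_span n \<Longrightarrow> polyhedral_cone n D \<Longrightarrow> M f (char_fun D) = L D f"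
    by metis
  have Madd: "M h (f + g) = M h f + M h g" if "h \<in> cone_span n" for h f g
    using M(1)[OF that] by (simp add: Vector_Spaces.linear_iff)
  have Mscale: "M h (cscale c f) = cscale c (M h f)" if "h \<in> cone_span n" for h f c
    using M(1)[OF that] by (simp add: Vector_Spaces.linear_iff)
  have M0: "M h 0 = 0" if "h \<in> cone_span n" for h
    using Mscale[OF that, of 0 0] by simp
  have Mspan: "M f g \<in> cone_span n" if "f \<in> cone_span n" "g \<in> cone_span n" for f g
    using that(2)
    by (rule cone_span_induct)
      (auto simp: M0 Madd Mscale M(2) that(1) cone_span_zero
        intro: cone_span_add cone_span_scale Lspan)
  \<comment> \<open>\<open>M f\<close> was chosen separately for each \<open>f\<close>, so its
    linearity in \<open>f\<close> has to be recovered by comparing both sides on indicators of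
    cones.\<close>
  have Madd': "M (f + g) h = M f h + M g h"
    if "f \<in> cone_span n" "g \<in> cone_span n" "h \<in> cone_span n" for f g h
    using that(3)
    by (rule cone_span_induct)
      (auto simp: M0 Madd Mscale M(2) that(1,2) cone_span_add Ladd cfun.scale_right_distrib)
  have Mscale': "M (cscale c f) h = cscale c (M f h)"
    if "f \<in> cone_span n" "h \<in> cone_span n" for c f h
    using that(2)
    by (rule cone_span_induct)
      (auto simp: M0 Madd Mscale M(2) that(1) cone_span_scale Lscale cfun.scale_right_distrib mult.commute)
  define p where "p f g = (if f \<in> cone_span n \<and> g \<in> cone_span n then M f g else 0)" for f g
  have "is_convolution n p"
    unfolding is_convolution_def p_def
    by (auto simp: Mspan Madd Madd' Mscale Mscale' cone_span_add cone_span_scale cone_span_char M(2) L(2))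
  then show ?thesis by (rule exI[of _ p])
qed

lemma convolution_unique:
  assumes p: "is_convolution n p" and q: "is_convolution n q"
  shows "p = q"
proof (rule ext, rule ext)
  fix f g
  show "p f g = q f g"
  proof (cases "f \<in> cone_span n \<and> g \<in> cone_span n")
    case True
    have conv0: "r 0 h = 0" "r h 0 = 0" if "is_convolution n r" "h \<in> cone_span n" for r h
    proof -
      have "r (cscale 0 0) h = cscale 0 (r 0 h)" "r h (cscale 0 0) = cscale 0 (r h 0)"
        using that cone_span_zero unfolding is_convolution_def by blast+
      then show "r 0 h = 0" "r h 0 = 0" by simp_all
    qed
    have g: "p (char_fun C) g = q (char_fun C) g" if C: "polyhedral_cone n C" for C
      using True[THEN conjunct2]
    proof (induction rule: cone_span_induct)
      case zero
      then show ?case using conv0(2)[OF p cone_span_char[OF C]] conv0(2)[OF q cone_span_char[OF C]] by simp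
    next
      case (add f g)
      then show ?case using p q cone_span_char[OF C] unfolding is_convolution_def by metis
    next
      case (scale c f)
      then show ?case using p q cone_span_char[OF C] unfolding is_convolution_def by metis
    next
      case (cone D)
      then show ?case using p q C unfolding is_convolution_def by metis
    qed
    show ?thesis using True[THEN conjunct1]
    proof (induction rule: cone_span_induct)
      case zero
      then show ?case using True conv0(1)[OF p] conv0(1)[OF q] by simp
    next
      case (add f g)
      then show ?case using p q True unfolding is_convolution_def by metis
    next
      case (scale c f)
      then show ?case using p q True unfolding is_convolution_def by metis
    next
      case (cone D)
      then show ?case by (rule g)
    qed
  next
    case False
    then show ?thesis using p q unfolding is_convolution_def by metis
  qed
qed

lemma is_convolution_conv: "is_convolution n (conv n)"
  unfolding conv_def using ex_convolution convolution_unique by (metis theI)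

lemma
  assumes "f \<in> cone_span n" "g \<in> cone_span n"
  shows conv_in_cone_span: "conv n f g \<in> cone_span n"
    and conv_add_left: "h \<in> cone_span n \<Longrightarrow> conv n (f + g) h = conv n f h + conv n g h"
    and conv_add_right: "h \<in> cone_span n \<Longrightarrow> conv n h (f + g) = conv n h f + conv n h g"
    and conv_scale_left: "conv n (cscale c f) g = cscale c (conv n f g)"
    and conv_scale_right: "conv n f (cscale c g) = cscale c (conv n f g)"
  using is_convolution_conv[of n] assms unfolding is_convolution_def by blast+

lemma conv_char:
  "polyhedral_cone n C \<Longrightarrow> polyhedral_cone n D \<Longrightarrow> conv n (char_fun C) (char_fun D) = char_fun (C + D)"
  using is_convolution_conv[of n] unfolding is_convolution_def by blast

lemma conv_undefined: "f \<notin> cone_span n \<or> g \<notin> cone_span n \<Longrightarrow> conv n f g = 0"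
  using is_convolution_conv[of n] unfolding is_convolution_def by blast

text \<open>The default value 0 outside the span extends this to every \<open>f\<close>.\<close>

lemma conv_zero_left: "conv n 0 f = 0"
  using conv_scale_left[of 0 n f 0] conv_undefined[of 0 n f] cone_span_zero by fastforce

lemma conv_zero_right: "conv n f 0 = 0"
  using conv_scale_right[of f n 0 0] conv_undefined[of f n 0] cone_span_zero by fastforce

lemma cone_span_sum: "(\<And>i. i \<in> I \<Longrightarrow> f i \<in> cone_span n) \<Longrightarrow> sum f I \<in> cone_span n"
  by (simp add: cone_span_def cfun.span_sum)

lemma conv_sum_left:
  assumes "\<And>i. i \<in> I \<Longrightarrow> f i \<in> cone_span n" "g \<in> cone_span n"
  shows "conv n (\<Sum>i\<in>I. f i) g = (\<Sum>i\<in>I. conv n (f i) g)"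
  using assms
  by (induction I rule: infinite_finite_induct) (auto simp: conv_zero_left conv_add_left cone_span_sum)

lemma conv_sum_right:
  assumes "\<And>i. i \<in> I \<Longrightarrow> f i \<in> cone_span n" "g \<in> cone_span n"
  shows "conv n g (\<Sum>i\<in>I. f i) = (\<Sum>i\<in>I. conv n g (f i))"
  using assms
  by (induction I rule: infinite_finite_induct) (auto simp: conv_zero_right conv_add_right cone_span_sum)

text \<open>On cones this is left commutativity of the Minkowski sum, and linearity in the three
  arguments does the rest; for \<open>h\<close> outside the span both sides are 0. A fold over a set
  of factors relies on it.\<close>

lemma conv_left_commute:
  assumes f: "f \<in> cone_span n" and g: "g \<in> cone_span n"
  shows "conv n f (conv n g h) = conv n g (conv n f h)"
proof (cases "h \<in> cone_span n")
  case True
  have *: "conv n (char_fun C) (conv n (char_fun D) h) = conv n (char_fun D) (conv n (char_fun C) h)"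
    if C: "polyhedral_cone n C" and D: "polyhedral_cone n D" for C D
    using True
    by (rule cone_span_induct)
      (auto simp: conv_zero_right conv_add_right conv_scale_right conv_in_cone_span cone_span_char
        C D conv_char polyhedral_cone_plus add.left_commute)
  have **: "conv n (char_fun C) (conv n g h) = conv n g (conv n (char_fun C) h)"
    if C: "polyhedral_cone n C" for C
    using g
    by (rule cone_span_induct)
      (auto simp: conv_zero_right conv_add_right conv_scale_right conv_zero_left conv_add_left
        conv_scale_left conv_in_cone_span cone_span_char True C *)
  show ?thesis
    using f
    by (rule cone_span_induct)
      (auto simp: conv_zero_right conv_add_right conv_scale_right conv_zero_left conv_add_left
        conv_scale_left conv_in_cone_span cone_span_char True g **)
next
  case False
  then show ?thesis by (simp add: conv_undefined conv_zero_right)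
qed

end

section \<open>Quasi-shuffles\<close>

text \<open>Signed sum of \<open>F\<close> over all quasi-shuffles of two words, where \<open>m\<close> merges letters and every
  merge contributes a factor \<open>-1\<close>.\<close>

fun qshuffle :: "('a \<Rightarrow> 'a \<Rightarrow> 'a) \<Rightarrow> ('a list \<Rightarrow> 'b::ab_group_add) \<Rightarrow> 'a list \<Rightarrow> 'a list \<Rightarrow> 'b" where
  "qshuffle m F [] B = F B"
| "qshuffle m F (a # A) [] = F (a # A)"
| "qshuffle m F (a # A) (b # B) =
     qshuffle m (\<lambda>W. F (a # W)) A (b # B) + qshuffle m (\<lambda>W. F (b # W)) (a # A) B
     - qshuffle m (\<lambda>W. F (m a b # W)) A B"

lemma qshuffle_Nil2 [simp]: "qshuffle m F A [] = F A"
  by (cases A) auto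

text \<open>\<open>qshuffle\<close> recurses from the front, whereas conditions on prefixes have to
  be peeled off at the back.\<close>

lemma qshuffle_snoc:
  "qshuffle m F (A @ [a]) (B @ [b]) =
     qshuffle m (\<lambda>W. F (W @ [a])) A (B @ [b]) + qshuffle m (\<lambda>W. F (W @ [b])) (A @ [a]) B
     - qshuffle m (\<lambda>W. F (W @ [m a b])) A B"
proof (induction A arbitrary: F B)
  case Nil
  show ?case
  proof (induction B arbitrary: F)
    case (Cons b' B)
    show ?case using Cons[of "\<lambda>W. F (b' # W)"] by (simp add: algebra_simps)
  qed simp
next
  case (Cons a' A)
  note IH = Cons.IH
  show ?case
  proof (induction B arbitrary: F)
    case Nil
    show ?case using IH[of "\<lambda>W. F (a' # W)" "[]"] by (simp add: algebra_simps)
  next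
    case (Cons b' B)
    show ?case
      unfolding append_Cons qshuffle.simps IH[of _ "b' # B", unfolded append_Cons] IH[of _ B]
        Cons[unfolded append_Cons]
      by (simp add: algebra_simps)
  qed
qed

text \<open>Meant for \<open>v\<close> a block sum: merging disjoint blocks adds their sums.\<close>

lemma qshuffle_map:
  assumes "\<And>a b. a \<in> set A \<Longrightarrow> b \<in> set B \<Longrightarrow> v (m a b) = m' (v a) (v b)"
  shows "qshuffle m (\<lambda>W. F (map v W)) A B = qshuffle m' F (map v A) (map v B)"
  using assms
proof (induction A arbitrary: F B)
  case (Cons a A)
  note IHA = Cons.IH
  show ?case using Cons.prems
  proof (induction B arbitrary: F)
    case (Cons b B)
    then show ?case
      using IHA[of "b # B" "\<lambda>W. F (v a # W)"] IHA[of B "\<lambda>W. F (m' (v a) (v b) # W)"]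
        Cons.IH[of "\<lambda>W. F (v b # W)"]
      by simp
  qed simp
qed simp

lemma qshuffle_apply: "qshuffle m F A B x = qshuffle m (\<lambda>W. F W x) A B"
  by (induction m F A B rule: qshuffle.induct) simp_all

lemma qshuffle_add:
  "qshuffle m (\<lambda>W. F W + G W) A B = qshuffle m F A B + qshuffle m G A B"
proof (induction A arbitrary: F G B)
  case (Cons a A)
  show ?case by (induction B arbitrary: F G) (simp_all add: Cons.IH algebra_simps)
qed simp

lemma qshuffle_mult:
  fixes c :: "'b::ring"
  shows "qshuffle m (\<lambda>W. c * F W) A B = c * qshuffle m F A B"
  by (induction m F A B rule: qshuffle.induct) (simp_all add: algebra_simps)

text \<open>All quasi-shuffles of two words of numbers have the same total, so a condition on the
  total behaves like a constant factor.\<close>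

lemma qshuffle_cong_sum:
  fixes A B :: "real list"
  assumes "\<And>W. sum_list W = sum_list A + sum_list B \<Longrightarrow> F W = G W"
  shows "qshuffle (+) F A B = qshuffle (+) G A B"
  using assms
proof (induction A arbitrary: F G B)
  case (Cons a A)
  note IHA = Cons.IH
  show ?case using Cons.prems
  proof (induction B arbitrary: F G)
    case (Cons b B)
    have "qshuffle (+) (\<lambda>W. F (a # W)) A (b # B) = qshuffle (+) (\<lambda>W. G (a # W)) A (b # B)"
      "qshuffle (+) (\<lambda>W. F ((a + b) # W)) A B = qshuffle (+) (\<lambda>W. G ((a + b) # W)) A B"
      by (rule IHA, rule Cons.prems, simp)+
    moreover have "qshuffle (+) (\<lambda>W. F (b # W)) (a # A) B = qshuffle (+) (\<lambda>W. G (b # W)) (a # A) B"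
      by (rule Cons.IH, rule Cons.prems, simp)
    ultimately show ?case by simp
  qed simp
qed simp

section \<open>Sign conditions on partial sums\<close>

definition suffixes_nonpos :: "real list \<Rightarrow> bool" where
  "suffixes_nonpos A \<longleftrightarrow> (\<forall>j<length A. sum_list (drop j A) \<le> 0)"

definition prefixes_nonneg :: "real list \<Rightarrow> bool" where
  "prefixes_nonneg A \<longleftrightarrow> (\<forall>j\<in>{1..length A}. 0 \<le> sum_list (take j A))"

lemma suffixes_nonpos_simps [simp]:
  "suffixes_nonpos []"
  "suffixes_nonpos (a # A) \<longleftrightarrow> a + sum_list A \<le> 0 \<and> suffixes_nonpos A"
  by (auto simp: suffixes_nonpos_def less_Suc_eq_0_disj)

lemma prefixes_nonneg_simps [simp]:
  "prefixes_nonneg []"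
  "prefixes_nonneg (A @ [a]) \<longleftrightarrow> 0 \<le> sum_list A + a \<and> prefixes_nonneg A"
  by (auto simp: prefixes_nonneg_def atLeastAtMostSuc_conv)

text \<open>With \<alpha> and \<beta> the totals of the two words, the three terms of the recursion
  combine by [\<alpha> + \<beta> \<le> 0] ([\<alpha> \<le> 0] + [\<beta> \<le> 0] - 1) =
  [\<alpha> \<le> 0] [\<beta> \<le> 0]. The -1 comes from the merged letter.\<close>

lemma qshuffle_suffixes_nonpos:
  "qshuffle (+) (\<lambda>W. of_bool (suffixes_nonpos W)) A B
     = (of_bool (suffixes_nonpos A) * of_bool (suffixes_nonpos B) :: 'b::comm_ring_1)"
proof (induction A arbitrary: B)
  case (Cons a A)
  note IHA = Cons.IH
  show ?case
  proof (induction B)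
    case (Cons b B)
    \<comment> \<open>The condition on the longest suffix concerns the total only, which is common
      to all quasi-shuffles, and therefore factors out.\<close>
    have *: "qshuffle (+) (\<lambda>W. of_bool (suffixes_nonpos (c # W))) A' B'
        = (of_bool (a + b + sum_list A + sum_list B \<le> 0) *
           qshuffle (+) (\<lambda>W. of_bool (suffixes_nonpos W)) A' B' :: 'b)"
      if "c + sum_list A' + sum_list B' = a + b + sum_list A + sum_list B" for c A' B'
      unfolding qshuffle_mult[symmetric]
      by (rule qshuffle_cong_sum) (use that in \<open>auto simp: algebra_simps\<close>)
    show ?case
      using Cons.IH IHA[of "b # B"] IHA[of B]
      by (auto simp: * algebra_simps simp del: suffixes_nonpos_simps(2))
         (auto simp: of_bool_def)
  qed simp
qed simp

text \<open>Mirror image of the suffix case, with the recursion running from the back.\<close>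

lemma qshuffle_prefixes_nonneg:
  "qshuffle (+) (\<lambda>W. of_bool (prefixes_nonneg W)) A B
     = (of_bool (prefixes_nonneg A) * of_bool (prefixes_nonneg B) :: 'b::comm_ring_1)"
proof (induction A arbitrary: B rule: rev_induct)
  case (snoc a A)
  note IHA = snoc.IH
  show ?case
  proof (induction B rule: rev_induct)
    case (snoc b B)
    have *: "qshuffle (+) (\<lambda>W. of_bool (prefixes_nonneg (W @ [c]))) A' B'
        = (of_bool (0 \<le> a + b + sum_list A + sum_list B) *
           qshuffle (+) (\<lambda>W. of_bool (prefixes_nonneg W)) A' B' :: 'b)"
      if "c + sum_list A' + sum_list B' = a + b + sum_list A + sum_list B" for c A' B'
      unfolding qshuffle_mult[symmetric]
      by (rule qshuffle_cong_sum) (use that in \<open>auto simp: algebra_simps\<close>)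
    show ?case unfolding qshuffle_snoc
      using snoc.IH IHA[of "B @ [b]"] IHA[of B]
      by (auto simp: * algebra_simps simp del: prefixes_nonneg_simps(2))
         (auto simp: of_bool_def)
  qed simp
qed simp

text \<open>The deconcatenation coproduct of the quasi-shuffle algebra, evaluated with
  \<open>F\<close>.\<close>

definition split_sum :: "('a list \<Rightarrow> 'a list \<Rightarrow> 'b::comm_monoid_add) \<Rightarrow> 'a list \<Rightarrow> 'b" where
  "split_sum F A = (\<Sum>i\<le>length A. F (take i A) (drop i A))"

lemma split_sum_simps [simp]:
  "split_sum F [] = F [] []"
  "split_sum F (a # A) = F [] (a # A) + split_sum (\<lambda>U. F (a # U)) A"
  unfolding split_sum_def by (simp_all add: sum.atMost_Suc_shift del: sum.atMost_Suc)

lemma split_sum_add: "split_sum (\<lambda>U V. F U V + G U V) A = split_sum F A + split_sum G A"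
  by (simp add: split_sum_def sum.distrib)

lemma split_sum_diff:
  fixes F :: "_ \<Rightarrow> _ \<Rightarrow> 'b::ab_group_add"
  shows "split_sum (\<lambda>U V. F U V - G U V) A = split_sum F A - split_sum G A"
  by (simp add: split_sum_def sum_subtractf)

text \<open>Deconcatenation is a homomorphism for the quasi-shuffle product.\<close>

lemma qshuffle_split_sum:
  fixes f h :: "'a list \<Rightarrow> 'b::comm_ring_1"
  assumes h: "\<And>A B. qshuffle m h A B = h A * h B"
  shows "qshuffle m (split_sum (\<lambda>U V. f U * h V)) A B
     = split_sum (\<lambda>U V. split_sum (\<lambda>U' V'. qshuffle m f U U' * h V * h V') B) A"
proof (induction A arbitrary: f B)
  case Nil
  have "h [] * h V = h V" for V using h[of "[]" V] by simp
  then show ?case by (simp add: mult.assoc)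
next
  case (Cons a A)
  note IHA = Cons.IH
  show ?case
  proof (induction B arbitrary: f)
    case Nil
    have "h V * h [] = h V" for V using h[of V "[]"] by simp
    then show ?case by (simp add: mult.assoc)
  next
    case (Cons b B)
    \<comment> \<open>This collects the cuts before the first letter: over the three terms of the
      recursion the uncut words add up to \<open>qshuffle m h\<close>, and multiplicativity of
      \<open>h\<close> applies.\<close>
    have "f [] * h (a # A) * h (b # B) = f [] * qshuffle m h (a # A) (b # B)"
      by (simp add: h del: qshuffle.simps)
    then show ?case
      by (simp add: qshuffle_add qshuffle_mult IHA Cons.IH)
         (simp add: split_sum_add split_sum_diff algebra_simps)
  qed
qed

section \<open>Convolution of graduated blades\<close>

lemma osp_Nil [simp]: "osp U [] \<longleftrightarrow> U = {}"
  by (auto simp: osp_def partition_on_def)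

text \<open>Replaces disjointness and distinctness by a recursion on the list, in which the ground
  set shrinks by the first block.\<close>

lemma osp_Cons [simp]: "osp U (a # W) \<longleftrightarrow> a \<noteq> {} \<and> a \<subseteq> U \<and> osp (U - a) W"
proof
  assume "osp U (a # W)"
  then have "a \<noteq> {}" "a \<notin> set W" "distinct W" "\<Union>(set W) \<union> a = U" "disjoint (insert a (set W))"
    "{} \<notin> set W"
    by (auto simp: osp_def partition_on_def)
  moreover from this have "disjoint (set W)" "\<And>b. b \<in> set W \<Longrightarrow> a \<inter> b = {}"
    by (auto simp: disjoint_def)
  ultimately show "a \<noteq> {} \<and> a \<subseteq> U \<and> osp (U - a) W"
    by (auto simp: osp_def partition_on_def)
next
  assume *: "a \<noteq> {} \<and> a \<subseteq> U \<and> osp (U - a) W"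
  then have W: "distinct W" "\<Union>(set W) = U - a" "disjoint (set W)" "{} \<notin> set W"
    by (auto simp: osp_def partition_on_def)
  then have "a \<notin> set W" using * by auto
  moreover have "disjoint (insert a (set W))"
    using W by (auto simp: disjoint_def)
  ultimately show "osp U (a # W)" using * W by (auto simp: osp_def partition_on_def)
qed

lemma osp_Union: "osp U W \<Longrightarrow> \<Union>(set W) = U"
  by (auto simp: osp_def partition_on_def)

lemma osp_append: "osp U (V @ W) \<longleftrightarrow> osp (\<Union>(set V)) V \<and> \<Union>(set V) \<subseteq> U \<and> osp (U - \<Union>(set V)) W"
proof (induction V arbitrary: U)
  case (Cons a V)
  have "osp (a \<union> \<Union>(set V) - a) V \<longleftrightarrow> osp (\<Union>(set V)) V \<and> a \<inter> \<Union>(set V) = {}"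
    using osp_Union[of "a \<union> \<Union>(set V) - a" V] by (auto simp: Un_Diff Diff_triv Int_commute)
  moreover have "U - (a \<union> \<Union>(set V)) = U - a - \<Union>(set V)" by blast
  ultimately show ?case using Cons[of "U - a"] by auto
qed simp

lemma osp_nth_unique:
  assumes "osp U W" "i < length W" "j < length W" "x \<in> W ! i" "x \<in> W ! j"
  shows "i = j"
proof -
  have d: "distinct W" "disjoint (set W)" using assms(1) by (auto simp: osp_def partition_on_def)
  have "W ! i \<inter> W ! j \<noteq> {}" using assms(4,5) by blast
  then have "W ! i = W ! j" using disjointD[OF d(2) nth_mem[OF assms(2)] nth_mem[OF assms(3)]] by blast
  then show ?thesis using d(1) assms(2,3) by (simp add: nth_eq_iff_index_eq)
qed

lemma osp_rotate: "osp U W \<Longrightarrow> osp U (rotate j W)"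
  by (simp add: osp_def)

definition block_sum :: "vec \<Rightarrow> nat set \<Rightarrow> real" where
  "block_sum x S = (\<Sum>i\<in>S. x i)"

lemma sum_Union_osp:
  assumes "osp U W" "finite U"
  shows "sum_list (map (block_sum x) W) = (\<Sum>i\<in>U. x i)"
  using assms
proof (induction W arbitrary: U)
  case (Cons a W)
  then show ?case using sum.subset_diff[of a U x] by (simp add: block_sum_def)
qed simp

lemma osp_take: "osp U W \<Longrightarrow> osp (\<Union>(set (take j W))) (take j W)"
  using osp_append[of U "take j W" "drop j W"] by simp

lemma osp_drop_Cons_take:
  assumes "osp U (T # A)"
  shows "osp U (drop i A @ T # take i A)"
proof -
  have "set (drop i A @ T # take i A) = set (T # A)"
    using set_append[of "take i A" "drop i A"] by auto
  moreover have "distinct (drop i A @ T # take i A)"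
    using assms set_take_disj_set_drop_if_distinct[of A i i]
    by (auto simp: osp_def dest: in_set_takeD in_set_dropD)
  ultimately show ?thesis using assms by (simp add: osp_def)
qed

text \<open>Plates and sums of plates all have this shape, with \<open>\<Phi>\<close> a condition on the block sums.\<close>

definition slab :: "nat \<Rightarrow> nat set \<Rightarrow> (vec \<Rightarrow> bool) \<Rightarrow> vec set" where
  "slab n U \<Phi> = {x \<in> V0 n. (\<forall>i. i \<notin> U \<longrightarrow> x i = 0) \<and> \<Phi> x}"

lemma sum_eq_0_V0:
  assumes "x \<in> V0 n" "\<And>i. i \<notin> U \<Longrightarrow> x i = 0" "U \<subseteq> {1..n}"
  shows "(\<Sum>i\<in>U. x i) = 0"
proof -
  have "(\<Sum>i\<in>U. x i) = (\<Sum>i=1..n. x i)"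
    using assms by (intro sum.mono_neutral_left) auto
  then show ?thesis using assms(1) by (simp add: V0_def)
qed

lemma plate_split:
  assumes osp: "osp U (T # A)" and U: "U \<subseteq> {1..n}" and i: "i \<le> length A"
  shows "plate n (drop i A @ T # take i A) = slab n U (\<lambda>x.
    suffixes_nonpos (map (block_sum x) (take i A)) \<and> prefixes_nonneg (map (block_sum x) (drop i A)))"
proof (intro set_eqI)
  fix x
  define V where "V = drop i A @ T # take i A"
  have lenV: "length V = Suc (length A)" using i by (simp add: V_def)
  have ospV: "osp U V" unfolding V_def by (rule osp_drop_Cons_take[OF osp])
  have fin: "finite U" using U finite_subset by blast
  have UV: "\<Union>(set V) = U" using osp_Union[OF ospV] .
  show "x \<in> plate n (drop i A @ T # take i A) \<longleftrightarrow> x \<in> slab n U (\<lambda>x.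
    suffixes_nonpos (map (block_sum x) (take i A)) \<and> prefixes_nonneg (map (block_sum x) (drop i A)))"
  proof (cases "x \<in> V0 n \<and> (\<forall>i. i \<notin> U \<longrightarrow> x i = 0)")
    case True
    then have tot: "(\<Sum>i\<in>U. x i) = 0" using sum_eq_0_V0 U by blast
    define f where "f = sum_list \<circ> map (block_sum x)"
    have fapp: "f (W @ W') = f W + f W'" for W W' by (simp add: f_def)
    have fV: "f V = 0" using sum_Union_osp[OF ospV fin] tot by (simp add: f_def)
    have take: "(\<Sum>i\<in>\<Union>(set (take j V)). x i) = f (take j V)" for j
      using sum_Union_osp[OF osp_take[OF ospV]] osp_append[of U "take j V" "drop j V"] ospV
        finite_subset[OF _ fin] by (simp add: f_def)
    have len: "length (drop i A) = length A - i" "length (take i A) = i" using i by simp_all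
    \<comment> \<open>Prefixes are split by the position of \<open>T\<close>: lengths up to
      \<open>length A - i\<close> stop before it, and length \<open>Suc (length A - i) + l\<close>
      takes in \<open>T\<close> and \<open>l\<close> further blocks.\<close>
    have "(\<forall>j\<in>{1..<length V}. 0 \<le> f (take j V)) \<longleftrightarrow>
        (\<forall>j\<in>{1..length A - i}. 0 \<le> f (take j V)) \<and> (\<forall>l<i. 0 \<le> f (take (Suc (length A - i) + l) V))"
    proof -
      have eq: "{1..<length V} = {1..length A - i} \<union> (\<lambda>l. Suc (length A - i) + l) ` {..<i}"
      proof (intro set_eqI iffI)
        fix j assume "j \<in> {1..<length V}"
        then show "j \<in> {1..length A - i} \<union> (\<lambda>l. Suc (length A - i) + l) ` {..<i}"
          using i lenV by (cases "j \<le> length A - i")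
            (auto intro!: image_eqI[of _ _ "j - Suc (length A - i)"])
      qed (use i lenV in auto)
      show ?thesis unfolding eq ball_Un by auto
    qed
    also have "(\<forall>j\<in>{1..length A - i}. 0 \<le> f (take j V)) \<longleftrightarrow> prefixes_nonneg (map (block_sum x) (drop i A))"
      unfolding prefixes_nonneg_def by (auto simp: V_def f_def take_map)
    also have "(\<forall>l<i. 0 \<le> f (take (Suc (length A - i) + l) V)) \<longleftrightarrow> suffixes_nonpos (map (block_sum x) (take i A))"
    proof -
      \<comment> \<open>The total over \<open>U\<close> is 0, so a prefix sum beyond
        \<open>T\<close> is minus the sum over the remaining blocks.\<close>
      have "f (take (Suc (length A - i) + l) V) = - f (drop l (take i A))" if "l < i" for l
      proof -
        have "take (Suc (length A - i) + l) V = drop i A @ T # take l (take i A)"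
          by (simp add: V_def)
        then have "f (take (Suc (length A - i) + l) V) + f (drop l (take i A)) = f V"
          unfolding fapp[symmetric] V_def by (simp only: append_assoc append_Cons append_take_drop_id)
        then show ?thesis using fV by simp
      qed
      then show ?thesis using i by (simp add: suffixes_nonpos_def f_def drop_map)
    qed
    finally have "(\<forall>j\<in>{1..<length V}. 0 \<le> f (take j V)) \<longleftrightarrow>
       prefixes_nonneg (map (block_sum x) (drop i A)) \<and> suffixes_nonpos (map (block_sum x) (take i A))" .
    then show ?thesis using True UV unfolding V_def[symmetric] plate_def slab_def by (auto simp: take)
  next
    case False
    then show ?thesis using UV unfolding V_def[symmetric] plate_def slab_def by auto
  qed
qed

text \<open>Rotation by \<open>Suc i\<close> corresponds to the cut of \<open>A\<close> at
  \<open>i\<close>, the unrotated list to the cut at \<open>length A\<close>. Thus the summands of a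
  blade are indexed by the deconcatenations of \<open>A\<close>.\<close>

lemma blade_plates:
  "blade n (T # A) = (\<Sum>i\<le>length A. char_fun (plate n (drop i A @ T # take i A)))"
proof -
  have "blade n (T # A) = char_fun (plate n (T # A)) +
      (\<Sum>i<length A. char_fun (plate n (rotate (Suc i) (T # A))))"
    unfolding blade_def by (simp only: list.size add_0_right add_Suc_right sum.lessThan_Suc_shift rotate0 id_apply)
  also have "(\<Sum>i<length A. char_fun (plate n (rotate (Suc i) (T # A))))
      = (\<Sum>i<length A. char_fun (plate n (drop i A @ T # take i A)))"
    by (intro sum.cong) (auto simp: rotate_drop_take)
  finally show ?thesis
    unfolding lessThan_Suc_atMost[symmetric] sum.lessThan_Suc
    by (simp only: add.commute drop_all take_all order_refl append_Nil)
qed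

text \<open>The number of times the path of partial sums attains its minimum.\<close>

definition min_count :: "real list \<Rightarrow> complex" where
  "min_count = split_sum (\<lambda>U V. of_bool (suffixes_nonpos U) * of_bool (prefixes_nonneg V))"

text \<open>Both sign conditions are multiplicative for quasi-shuffles, and deconcatenation is
  compatible with the product.\<close>

lemma qshuffle_min_count: "qshuffle (+) min_count A B = min_count A * min_count B"
proof -
  have "qshuffle (+) min_count A B = split_sum (\<lambda>U V. split_sum (\<lambda>U' V'.
     qshuffle (+) (\<lambda>W. of_bool (suffixes_nonpos W)) U U' * of_bool (prefixes_nonneg V)
       * of_bool (prefixes_nonneg V')) B) A"
    unfolding min_count_def by (rule qshuffle_split_sum) (rule qshuffle_prefixes_nonneg)
  also have "\<dots> = min_count A * min_count B"
    unfolding min_count_def split_sum_def qshuffle_suffixes_nonpos sum_product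
    by (intro sum.cong refl) (simp only: mult_ac)
  finally show ?thesis .
qed

lemma blade_apply:
  assumes osp: "osp U (T # A)" and U: "U \<subseteq> {1..n}"
  shows "blade n (T # A) x =
    of_bool (x \<in> V0 n \<and> (\<forall>i. i \<notin> U \<longrightarrow> x i = 0)) * min_count (map (block_sum x) A)"
proof -
  have "blade n (T # A) x = (\<Sum>i\<le>length A. char_fun (plate n (drop i A @ T # take i A)) x)"
    unfolding blade_plates by (rule sum_fun_apply)
  also have "\<dots> = of_bool (x \<in> V0 n \<and> (\<forall>i. i \<notin> U \<longrightarrow> x i = 0)) * min_count (map (block_sum x) A)"
    unfolding min_count_def split_sum_def sum_distrib_left
    by (intro sum.cong) (auto simp: plate_split[OF assms] slab_def indicator_def take_map drop_map)
  finally show ?thesis .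
qed

text \<open>The coordinate \<open>t\<close> enters neither condition, so it can absorb the amount
  that makes each summand total 0.\<close>

lemma plus_slab:
  assumes "t \<in> T" "T \<inter> UA = {}" "T \<inter> UB = {}" "UA \<inter> UB = {}" "T \<union> UA \<union> UB \<subseteq> {1..n}"
    and \<Phi>: "\<And>x y. (\<And>i. i \<in> UA \<Longrightarrow> x i = y i) \<Longrightarrow> \<Phi> x \<longleftrightarrow> \<Phi> y"
    and \<Psi>: "\<And>x y. (\<And>i. i \<in> UB \<Longrightarrow> x i = y i) \<Longrightarrow> \<Psi> x \<longleftrightarrow> \<Psi> y"
  shows "slab n (T \<union> UA) \<Phi> + slab n (T \<union> UB) \<Psi> = slab n (T \<union> UA \<union> UB) (\<lambda>x. \<Phi> x \<and> \<Psi> x)"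
proof (intro set_eqI iffI)
  fix x assume "x \<in> slab n (T \<union> UA) \<Phi> + slab n (T \<union> UB) \<Psi>"
  then obtain y z where yz: "y \<in> slab n (T \<union> UA) \<Phi>" "z \<in> slab n (T \<union> UB) \<Psi>" "x = y + z"
    by (auto elim: set_plus_elim)
  have "\<Phi> x \<longleftrightarrow> \<Phi> y"
    by (rule \<Phi>) (use yz assms(2-4) in \<open>auto simp: slab_def\<close>)
  moreover have "\<Psi> x \<longleftrightarrow> \<Psi> z"
    by (rule \<Psi>) (use yz assms(2-4) in \<open>auto simp: slab_def\<close>)
  ultimately show "x \<in> slab n (T \<union> UA \<union> UB) (\<lambda>x. \<Phi> x \<and> \<Psi> x)"
    using yz by (auto simp: slab_def intro: V0_add)
next
  fix x assume x: "x \<in> slab n (T \<union> UA \<union> UB) (\<lambda>x. \<Phi> x \<and> \<Psi> x)"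
  \<comment> \<open>The first summand copies \<open>x\<close> on \<open>UA\<close> and is balanced
    at \<open>t\<close>; everything else, including the rest of \<open>T\<close>, is left to
    \<open>x - y\<close>.\<close>
  define y where "y = (\<lambda>i. if i \<in> UA then x i else if i = t then - (\<Sum>j\<in>UA. x j) else 0)"
  have tn: "t \<in> {1..n}" "t \<notin> UA" "t \<notin> UB" "UA \<subseteq> {1..n}" using assms by auto
  have "(\<Sum>i=1..n. y i) = (\<Sum>i\<in>insert t UA. y i)"
    using tn by (intro sum.mono_neutral_right) (auto simp: y_def)
  also have "\<dots> = 0"
    using tn finite_subset[OF tn(4)] by (simp add: y_def)
  finally have yV: "y \<in> V0 n" using tn by (auto simp: V0_def y_def)
  have "\<Phi> y" using x \<Phi>[of y x] by (simp add: y_def slab_def)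
  then have y: "y \<in> slab n (T \<union> UA) \<Phi>" using yV assms(1) by (auto simp: slab_def y_def)
  have "y i = 0" if "i \<in> UB" for i using that tn assms(4) by (auto simp: y_def)
  then have "\<Psi> (x - y)" using x \<Psi>[of "x - y" x] by (simp add: slab_def)
  then have "x - y \<in> slab n (T \<union> UB) \<Psi>"
    using x yV tn assms(1) by (auto simp: slab_def y_def intro!: V0_diff)
  then have "y + (x - y) \<in> slab n (T \<union> UA) \<Phi> + slab n (T \<union> UB) \<Psi>"
    using y by (intro set_plus_intro)
  then show "x \<in> slab n (T \<union> UA) \<Phi> + slab n (T \<union> UB) \<Psi>" by simp
qed

lemma polyhedral_cone_plate:
  assumes "osp U V" "U \<subseteq> {1..n}"
  shows "polyhedral_cone n (plate n V)"
proof -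
  define e where "e S = (\<lambda>i. of_bool (i \<in> S) :: real)" for S :: "nat set"
  \<comment> \<open>One functional for each proper prefix of blocks, and an opposite pair for each
    coordinate in \<open>{1..n} - U\<close>, which has to vanish.\<close>
  define A where "A = (\<lambda>j. e (\<Union>(set (take j V)))) ` {1..<length V}
    \<union> (\<lambda>i. e {i}) ` ({1..n} - U) \<union> (\<lambda>i j. - e {i} j) ` ({1..n} - U)"
  have e: "(\<Sum>i=1..n. e S i * x i) = (\<Sum>i\<in>S. x i)" if "S \<subseteq> {1..n}" for S x
  proof -
    have "(\<Sum>i=1..n. e S i * x i) = (\<Sum>i\<in>S. e S i * x i)"
      using that by (intro sum.mono_neutral_right) (auto simp: e_def)
    then show ?thesis by (simp add: e_def)
  qed
  have sub: "\<Union>(set (take j V)) \<subseteq> {1..n}" for j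
    using assms osp_append[of U "take j V" "drop j V"] by auto
  have "plate n V = {x \<in> V0 n. \<forall>a\<in>A. 0 \<le> (\<Sum>i=1..n. a i * x i)}"
  proof (intro set_eqI)
    fix x
    have "(\<forall>a\<in>A. 0 \<le> (\<Sum>i=1..n. a i * x i)) \<longleftrightarrow>
      (\<forall>j\<in>{1..<length V}. 0 \<le> (\<Sum>i\<in>\<Union>(set (take j V)). x i)) \<and>
      (\<forall>i\<in>{1..n} - U. 0 \<le> x i) \<and> (\<forall>i\<in>{1..n} - U. 0 \<le> - x i)"
    proof -
      have "(\<Sum>i'=1..n. e {i} i' * x i') = x i" if "i \<in> {1..n} - U" for i
        using that e[of "{i}" x] by simp
      then show ?thesis
        unfolding A_def ball_Un ball_simps(9) mult_minus_left sum_negf e[OF sub] by (simp del: One_nat_def)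
    qed
    moreover have "(\<forall>i. i \<notin> U \<longrightarrow> x i = 0) \<longleftrightarrow> (\<forall>i\<in>{1..n} - U. 0 \<le> x i) \<and> (\<forall>i\<in>{1..n} - U. 0 \<le> - x i)"
      if "x \<in> V0 n"
    proof (intro iffI allI impI)
      fix i assume *: "(\<forall>i\<in>{1..n} - U. 0 \<le> x i) \<and> (\<forall>i\<in>{1..n} - U. 0 \<le> - x i)" "i \<notin> U"
      show "x i = 0"
      proof (cases "i \<in> {1..n}")
        case True
        then have "0 \<le> x i" "0 \<le> - x i" using * by blast+
        then show ?thesis by simp
      qed (use that in \<open>auto simp: V0_def\<close>)
    qed auto
    ultimately show "x \<in> plate n V \<longleftrightarrow> x \<in> {x \<in> V0 n. \<forall>a\<in>A. 0 \<le> (\<Sum>i=1..n. a i * x i)}"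
      unfolding plate_def osp_Union[OF assms(1)] by auto
  qed
  moreover have "finite A" by (simp add: A_def)
  ultimately show ?thesis unfolding polyhedral_cone_def by blast
qed

lemma blade_in_cone_span:
  assumes "osp U V" "U \<subseteq> {1..n}"
  shows "blade n V \<in> cone_span n"
  unfolding blade_def
  by (rule cone_span_sum, rule cone_span_char, rule polyhedral_cone_plate[OF osp_rotate[OF assms(1)] assms(2)])

text \<open>A quasi-shuffle of ordered set partitions of disjoint sets is one of their union, so
  \<open>F\<close> is only ever evaluated at such words.\<close>

lemma qshuffle_cong_osp:
  assumes "osp UA A" "osp UB B" "UA \<inter> UB = {}"
    and "\<And>W. osp (UA \<union> UB) W \<Longrightarrow> F W = G W"
  shows "qshuffle (\<union>) F A B = qshuffle (\<union>) G A B"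
  using assms
proof (induction A arbitrary: F G B UA UB)
  case (Cons a A)
  note IHA = Cons.IH and premsA = Cons.prems
  show ?case using premsA(2-4)
  proof (induction B arbitrary: F G UB)
    case Nil
    then show ?case using premsA(1) by simp
  next
    case (Cons b B)
    note ab = premsA(1) Cons.prems
    have "qshuffle (\<union>) (\<lambda>W. F (a # W)) A (b # B) = qshuffle (\<union>) (\<lambda>W. G (a # W)) A (b # B)"
    proof (rule IHA[of "UA - a" UB])
      fix W assume W: "osp (UA - a \<union> UB) W"
      have "UA - a \<union> UB = UA \<union> UB - a" using ab by auto
      then show "F (a # W) = G (a # W)" using W ab by (intro ab(4)) auto
    qed (use ab in auto)
    moreover have "qshuffle (\<union>) (\<lambda>W. F (b # W)) (a # A) B = qshuffle (\<union>) (\<lambda>W. G (b # W)) (a # A) B"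
    proof (rule Cons.IH[of "UB - b"])
      fix W assume W: "osp (UA \<union> (UB - b)) W"
      have "UA \<union> (UB - b) = UA \<union> UB - b" using ab by auto
      then show "F (b # W) = G (b # W)" using W ab by (intro ab(4)) auto
    qed (use ab in auto)
    moreover have "qshuffle (\<union>) (\<lambda>W. F ((a \<union> b) # W)) A B = qshuffle (\<union>) (\<lambda>W. G ((a \<union> b) # W)) A B"
    proof (rule IHA[of "UA - a" "UB - b"])
      fix W assume W: "osp (UA - a \<union> (UB - b)) W"
      have "UA - a \<union> (UB - b) = UA \<union> UB - (a \<union> b)" using ab by auto
      then show "F ((a \<union> b) # W) = G ((a \<union> b) # W)" using W ab by (intro ab(4)) auto
    qed (use ab in auto)
    ultimately show ?case by simp
  qed
qed simp

lemma conv_blades: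
  assumes T: "t \<in> T" "T \<inter> UA = {}" "T \<inter> UB = {}" "UA \<inter> UB = {}" "T \<union> UA \<union> UB \<subseteq> {1..n}"
    and A: "osp UA A" and B: "osp UB B"
  shows "conv n (blade n (T # A)) (blade n (T # B)) = qshuffle (\<union>) (\<lambda>W. blade n (T # W)) A B"
proof (rule ext)
  fix x
  let ?in = "of_bool (x \<in> V0 n \<and> (\<forall>i. i \<notin> T \<union> UA \<union> UB \<longrightarrow> x i = 0)) :: complex"
  have ospT: "osp (T \<union> U) (T # W)" if "osp U W" "T \<inter> U = {}" for U W
  proof -
    have "T \<union> U - T = U" using that by auto
    then show ?thesis using that T(1) by auto
  qed
  have oA: "osp (T \<union> UA) (T # A)" and oB: "osp (T \<union> UB) (T # B)" using A B T ospT by auto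
  have nA: "T \<union> UA \<subseteq> {1..n}" and nB: "T \<union> UB \<subseteq> {1..n}" using T by auto
  define \<Phi> where "\<Phi> A i x \<longleftrightarrow> suffixes_nonpos (map (block_sum x) (take i A)) \<and>
     prefixes_nonneg (map (block_sum x) (drop i A))" for A i x
  have \<Phi>: "\<Phi> A i x \<longleftrightarrow> \<Phi> A i y" if "osp U A" "\<And>i. i \<in> U \<Longrightarrow> x i = y i" for A U i x y
  proof -
    have "map (block_sum x) A = map (block_sum y) A"
      using that osp_Union[OF that(1)] by (auto simp: block_sum_def intro!: sum.cong)
    then show ?thesis unfolding \<Phi>_def take_map[symmetric] drop_map[symmetric] by (simp only:)
  qed
  define P where "P A i = plate n (drop i A @ T # take i A)" for A i
  have PA: "P A i = slab n (T \<union> UA) (\<Phi> A i)" if "i \<le> length A" for i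
    unfolding P_def \<Phi>_def by (rule plate_split[OF oA nA that])
  have PB: "P B i = slab n (T \<union> UB) (\<Phi> B i)" if "i \<le> length B" for i
    unfolding P_def \<Phi>_def by (rule plate_split[OF oB nB that])
  have cone: "polyhedral_cone n (P A i)" if "osp (T \<union> U) (T # A)" "T \<union> U \<subseteq> {1..n}" for A U i
    unfolding P_def using osp_drop_Cons_take[OF that(1)] that(2) by (rule polyhedral_cone_plate)
  note cA = cone[OF oA nA] and cB = cone[OF oB nB]
  have sum: "P A i + P B j = slab n (T \<union> UA \<union> UB) (\<lambda>x. \<Phi> A i x \<and> \<Phi> B j x)"
    if "i \<le> length A" "j \<le> length B" for i j
    unfolding PA[OF that(1)] PB[OF that(2)]
    by (rule plus_slab[OF T]) (use \<Phi>[OF A] \<Phi>[OF B] in blast)+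
  have "conv n (blade n (T # A)) (blade n (T # B))
      = (\<Sum>i\<le>length A. \<Sum>j\<le>length B. char_fun (P A i + P B j))"
    unfolding blade_plates P_def[symmetric]
    by (simp add: conv_sum_left conv_sum_right cone_span_char cone_span_sum cA cB conv_char)
      (rule sum.swap)
  then have "conv n (blade n (T # A)) (blade n (T # B)) x
      = (\<Sum>i\<le>length A. \<Sum>j\<le>length B. char_fun (P A i + P B j) x)"
    by (simp add: sum_fun_apply)
  \<comment> \<open>At \<open>x\<close> the indicator of a sum of two plates is a condition over
    \<open>A\<close> times a condition over \<open>B\<close>, so the double sum over cuts
    factorises.\<close>
  also have "\<dots> = ?in * (min_count (map (block_sum x) A) * min_count (map (block_sum x) B))"
    unfolding min_count_def split_sum_def sum_product unfolding sum_distrib_left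
    by (intro sum.cong) (auto simp: sum slab_def indicator_def \<Phi>_def take_map drop_map)
  \<comment> \<open>Multiplicativity for words of numbers is carried back to words of blocks, where
    a merge is a union of disjoint sets.\<close>
  also have "\<dots> = ?in * qshuffle (\<union>) (\<lambda>W. min_count (map (block_sum x) W)) A B"
  proof -
    have "block_sum x (a \<union> b) = block_sum x a + block_sum x b" if "a \<in> set A" "b \<in> set B" for a b
    proof -
      have "a \<subseteq> UA" "b \<subseteq> UB" using that osp_Union[OF A] osp_Union[OF B] by auto
      moreover from this have "finite a" "finite b" using T(5) by (meson finite_atLeastAtMost finite_subset le_sup_iff)+
      ultimately show ?thesis using T(4) unfolding block_sum_def by (intro sum.union_disjoint) auto
    qed
    then show ?thesis
      using qshuffle_map[where m = "(\<union>)" and m' = "(+)" and v = "block_sum x" and F = min_count]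
      by (simp add: qshuffle_min_count)
  qed
  also have "\<dots> = qshuffle (\<union>) (\<lambda>W. blade n (T # W) x) A B"
    unfolding qshuffle_mult[symmetric]
  proof (rule qshuffle_cong_osp[OF A B T(4)])
    fix W assume "osp (UA \<union> UB) W"
    then have "osp (T \<union> (UA \<union> UB)) (T # W)" using T by (intro ospT) auto
    then show "?in * min_count (map (block_sum x) W) = blade n (T # W) x"
      using blade_apply[of "T \<union> UA \<union> UB" T W n x] T(5) by (simp only: Un_assoc)
  qed
  finally show "conv n (blade n (T # A)) (blade n (T # B)) x
      = qshuffle (\<union>) (\<lambda>W. blade n (T # W)) A B x"
    by (simp add: qshuffle_apply)
qed

section \<open>Leading terms\<close>

context
  notes zero_fun_apply [simp del] plus_fun_apply [simp del] minus_apply [simp del]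
begin

text \<open>The key for triangularity, compared lexicographically. Different partitions can share a
  word, so all correction terms must be strictly smaller.\<close>

definition min_word :: "nat set list \<Rightarrow> nat list" where
  "min_word = map Min"

lemma min_word_simps [simp]:
  "min_word [] = []" "min_word (a # W) = Min a # min_word W"
  "min_word (V @ W) = min_word V @ min_word W"
  by (simp_all add: min_word_def)

lemma append_less_append_iff: "u @ v < u @ w \<longleftrightarrow> v < (w :: nat list)"
  by (induction u) simp_all

lemma span_Cons_mono:
  assumes "\<And>W. P W \<Longrightarrow> Q (a # W)"
  shows "cfun.span {F (a # W) |W. P W} \<subseteq> cfun.span {F W |W. Q W}"
  using assms by (intro cfun.span_mono) blast

lemma qshuffle_in_span:
  fixes F :: "nat set list \<Rightarrow> cfun"
  assumes "osp UA A" "osp UB B" "UA \<inter> UB = {}"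
  shows "qshuffle (\<union>) F A B \<in> cfun.span {F W |W. osp (UA \<union> UB) W}"
  using assms
proof (induction A arbitrary: F B UA UB)
  case Nil
  then show ?case by (auto intro: cfun.span_base)
next
  case (Cons a A)
  note IHA = Cons.IH and premsA = Cons.prems
  show ?case using premsA(2,3)
  proof (induction B arbitrary: F UB)
    case Nil
    then show ?case using premsA(1) by (auto intro!: cfun.span_base)
  next
    case (Cons b B)
    note ab = premsA(1) Cons.prems
    let ?S = "cfun.span {F W |W. osp (UA \<union> UB) W}"
    have "qshuffle (\<union>) (\<lambda>W. F (a # W)) A (b # B) \<in> cfun.span {F (a # W) |W. osp (UA - a \<union> UB) W}"
      using ab by (intro IHA) auto
    moreover have "UA - a \<union> UB = UA \<union> UB - a" using ab by auto
    then have "cfun.span {F (a # W) |W. osp (UA - a \<union> UB) W} \<subseteq> ?S"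
      using ab by (intro span_Cons_mono) auto
    moreover have "qshuffle (\<union>) (\<lambda>W. F (b # W)) (a # A) B \<in> cfun.span {F (b # W) |W. osp (UA \<union> (UB - b)) W}"
      using ab by (intro Cons.IH) auto
    moreover have "UA \<union> (UB - b) = UA \<union> UB - b" using ab by auto
    then have "cfun.span {F (b # W) |W. osp (UA \<union> (UB - b)) W} \<subseteq> ?S"
      using ab by (intro span_Cons_mono) auto
    moreover have "qshuffle (\<union>) (\<lambda>W. F ((a \<union> b) # W)) A B
        \<in> cfun.span {F ((a \<union> b) # W) |W. osp (UA - a \<union> (UB - b)) W}"
      using ab by (intro IHA) auto
    moreover have "UA - a \<union> (UB - b) = UA \<union> UB - (a \<union> b)" using ab by auto
    then have "cfun.span {F ((a \<union> b) # W) |W. osp (UA - a \<union> (UB - b)) W} \<subseteq> ?S"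
      using ab by (intro span_Cons_mono) auto
    ultimately show ?case
      unfolding qshuffle.simps by (intro cfun.span_diff cfun.span_add) blast+
  qed
qed

text \<open>In every quasi-shuffle other than \<open>A @ c # C\<close>, the block \<open>c\<close>
  appears, alone or merged, before \<open>A\<close> is exhausted. There it puts a smaller minimum in
  the place of some \<open>Min a\<close>, so the word drops however the rest is arranged.\<close>

lemma qshuffle_leading_term:
  fixes F :: "nat set list \<Rightarrow> cfun"
  assumes "osp UA A" "osp UC (c # C)" "UA \<inter> UC = {}" "finite UA" "finite UC"
    and "\<And>a. a \<in> set A \<Longrightarrow> Min c < Min a"
  shows "qshuffle (\<union>) F A (c # C) - F (A @ c # C)
    \<in> cfun.span {F W |W. osp (UA \<union> UC) W \<and> min_word W < min_word (A @ c # C)}"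
  using assms
proof (induction A arbitrary: F UA)
  case Nil
  then show ?case by (simp add: cfun.span_zero)
next
  case (Cons a A)
  note ab = Cons.prems
  let ?S = "cfun.span {F W |W. osp (UA \<union> UC) W \<and> min_word W < min_word ((a # A) @ c # C)}"
  have fin: "finite a" "finite c" using ab finite_subset by auto
  have "Min (a \<union> c) = min (Min a) (Min c)" using ab fin by (intro Min_Un) auto
  then have Min_ac: "Min (a \<union> c) < Min a" using ab(6)[of a] by simp
  have "qshuffle (\<union>) (\<lambda>W. F (a # W)) A (c # C) - F (a # (A @ c # C))
      \<in> cfun.span {F (a # W) |W. osp (UA - a \<union> UC) W \<and> min_word W < min_word (A @ c # C)}"
    using ab by (intro Cons.IH) auto
  moreover have "UA - a \<union> UC = UA \<union> UC - a" using ab by auto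
  then have "cfun.span {F (a # W) |W. osp (UA - a \<union> UC) W \<and> min_word W < min_word (A @ c # C)} \<subseteq> ?S"
    using ab by (intro span_Cons_mono) auto
  ultimately have 1: "qshuffle (\<union>) (\<lambda>W. F (a # W)) A (c # C) - F (a # (A @ c # C)) \<in> ?S" by blast
  have "qshuffle (\<union>) (\<lambda>W. F (c # W)) (a # A) C \<in> cfun.span {F (c # W) |W. osp (UA \<union> (UC - c)) W}"
    using ab by (intro qshuffle_in_span) auto
  moreover have "UA \<union> (UC - c) = UA \<union> UC - c" using ab by auto
  then have "cfun.span {F (c # W) |W. osp (UA \<union> (UC - c)) W} \<subseteq> ?S"
    using ab by (intro span_Cons_mono) auto
  ultimately have 2: "qshuffle (\<union>) (\<lambda>W. F (c # W)) (a # A) C \<in> ?S" by blast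
  have "qshuffle (\<union>) (\<lambda>W. F ((a \<union> c) # W)) A C
      \<in> cfun.span {F ((a \<union> c) # W) |W. osp (UA - a \<union> (UC - c)) W}"
    using ab by (intro qshuffle_in_span) auto
  moreover have "UA - a \<union> (UC - c) = UA \<union> UC - (a \<union> c)" using ab by auto
  then have "cfun.span {F ((a \<union> c) # W) |W. osp (UA - a \<union> (UC - c)) W} \<subseteq> ?S"
    using ab Min_ac by (intro span_Cons_mono) auto
  ultimately have 3: "qshuffle (\<union>) (\<lambda>W. F ((a \<union> c) # W)) A C \<in> ?S" by blast
  have "qshuffle (\<union>) F (a # A) (c # C) - F ((a # A) @ c # C)
      = (qshuffle (\<union>) (\<lambda>W. F (a # W)) A (c # C) - F (a # (A @ c # C)))
      + qshuffle (\<union>) (\<lambda>W. F (c # W)) (a # A) C - qshuffle (\<union>) (\<lambda>W. F ((a \<union> c) # W)) A C"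
    unfolding qshuffle.simps append_Cons by (simp only: algebra_simps)
  then show ?case using 1 2 3 by (simp only: cfun.span_add cfun.span_diff)
qed

text \<open>The shape of the cut pieces of \<open>U_B\<close>, listed from left to right.\<close>

definition decreasing_pieces :: "nat set list list \<Rightarrow> bool" where
  "decreasing_pieces Ss \<longleftrightarrow> (\<forall>A\<in>set Ss. A \<noteq> [] \<and> Min (\<Union>(set A)) \<in> hd A) \<and>
     sorted_wrt (\<lambda>A B. Min (\<Union>(set B)) < Min (\<Union>(set A))) Ss"

lemma decreasing_pieces_Cons:
  "decreasing_pieces (A # Ss) \<longleftrightarrow> A \<noteq> [] \<and> Min (\<Union>(set A)) \<in> hd A \<and>
     (\<forall>B\<in>set Ss. Min (\<Union>(set B)) < Min (\<Union>(set A))) \<and> decreasing_pieces Ss"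
  by (auto simp: decreasing_pieces_def)

lemma conv_zero_cone:
  assumes "f \<in> cone_span n"
  shows "conv n f (char_fun {0}) = f"
proof -
  \<comment> \<open>The zero cone is the plate of the empty partition, hence polyhedral.\<close>
  have "plate n [] = {0}" by (auto simp: plate_def V0_def zero_fun_def)
  then have 0: "polyhedral_cone n {0}" using polyhedral_cone_plate[of "{}" "[]" n] by simp
  have z: "char_fun {0} \<in> cone_span n" using cone_span_char[OF 0] .
  have "C + {0} = C" for C :: "vec set" by (auto simp: set_plus_def)
  then have cone: "conv n (char_fun C) (char_fun {0}) = char_fun C" if "polyhedral_cone n C" for C
    using conv_char[OF that 0] by simp
  show ?thesis using assms
  proof (rule cone_span_induct)
    show "conv n 0 (char_fun {0}) = 0" by (rule conv_zero_left)
  next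
    fix f g assume "f \<in> cone_span n" "g \<in> cone_span n"
      "conv n f (char_fun {0}) = f" "conv n g (char_fun {0}) = g"
    then show "conv n (f + g) (char_fun {0}) = f + g" by (simp only: conv_add_left z)
  next
    fix c f assume "f \<in> cone_span n" "conv n f (char_fun {0}) = f"
    then show "conv n (cscale c f) (char_fun {0}) = cscale c f" by (simp only: conv_scale_left z)
  qed (rule cone)
qed

text \<open>The bound \<open>w\<close> is kept apart from \<open>B\<close>, so that one estimate
  serves both the leading word of the remaining product and its lower words.\<close>

lemma conv_blade_lower:
  assumes T: "t \<in> T" "T \<inter> UA = {}" "T \<inter> UB = {}" "UA \<inter> UB = {}" "T \<union> UA \<union> UB \<subseteq> {1..n}"
    and A: "osp UA A" and B: "osp UB B" "B \<noteq> []"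
    and lt: "\<And>a. a \<in> set A \<Longrightarrow> Min (hd B) < Min a"
    and le: "min_word B \<le> w"
  shows "conv n (blade n (T # A)) (blade n (T # B)) - blade n (T # A @ B)
    \<in> cfun.span {blade n (T # W) |W. osp (UA \<union> UB) W \<and> min_word W < min_word A @ w}"
proof -
  obtain c C where B_eq: "B = c # C" using B(2) by (cases B) auto
  have "finite UA" "finite UB" using T(5) finite_subset by auto
  then have "conv n (blade n (T # A)) (blade n (T # B)) - blade n (T # A @ B)
    \<in> cfun.span {blade n (T # W) |W. osp (UA \<union> UB) W \<and> min_word W < min_word (A @ B)}"
    unfolding conv_blades[OF T A B(1)]
    using qshuffle_leading_term[of UA A UB c C "\<lambda>W. blade n (T # W)"] A B lt T(4) by (simp add: B_eq)
  moreover have "min_word (A @ B) \<le> min_word A @ w"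
    using le by (auto simp: append_less_append_iff order_le_less)
  then have "{blade n (T # W) |W. osp (UA \<union> UB) W \<and> min_word W < min_word (A @ B)}
    \<subseteq> {blade n (T # W) |W. osp (UA \<union> UB) W \<and> min_word W < min_word A @ w}"
    by (auto dest: less_le_trans)
  ultimately show ?thesis using cfun.span_mono by blast
qed

text \<open>Lower terms stay lower when the next piece \<open>A\<close> is multiplied on: a
  lexicographically smaller word does not have a larger first letter, so its first block still has a
  smaller minimum than every block of \<open>A\<close>.\<close>

lemma conv_pieces_leading_term:
  assumes "t \<in> T" "T \<inter> U = {}" "T \<union> U \<subseteq> {1..n}" "osp U (concat Ss)" "Ss \<noteq> []"
    and "decreasing_pieces Ss"
  shows "foldr (\<lambda>A. conv n (blade n (T # A))) Ss (char_fun {0}) - blade n (T # concat Ss)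
    \<in> cfun.span {blade n (T # W) |W. osp U W \<and> min_word W < min_word (concat Ss)}"
  using assms
proof (induction Ss arbitrary: U)
  case (Cons A Ss)
  define UA where "UA = \<Union>(set A)"
  define V where "V = U - UA"
  have osps: "osp UA A" "osp V (concat Ss)" "UA \<subseteq> U"
    using Cons.prems(4) by (auto simp: osp_append UA_def V_def)
  then have U: "U = UA \<union> V" "UA \<inter> V = {}" by (auto simp: V_def)
  have fin: "finite U" using Cons.prems(3) finite_subset by auto
  have TU: "T \<inter> UA = {}" "T \<inter> V = {}" "T \<union> UA \<union> V \<subseteq> {1..n}" using U Cons.prems(2,3) by auto
  have ospT: "osp (T \<union> W') (T # W)" if "osp W' W" "T \<inter> W' = {}" for W' W
  proof -
    have "T \<union> W' - T = W'" using that by auto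
    then show ?thesis using that Cons.prems(1) by auto
  qed
  have bA: "blade n (T # A) \<in> cone_span n"
    using blade_in_cone_span[OF ospT[OF osps(1) TU(1)]] TU(3) by auto
  show ?case
  proof (cases "Ss = []")
    case True
    then show ?thesis using conv_zero_cone[OF bA] by (simp add: cfun.span_zero)
  next
    case False
    have dec: "decreasing_pieces Ss" "Min UA \<in> hd A" "A \<noteq> []"
      "\<And>B. B \<in> set Ss \<Longrightarrow> Min (\<Union>(set B)) < Min UA"
      using Cons.prems(6) by (auto simp: decreasing_pieces_Cons UA_def)
    have ne: "concat Ss \<noteq> []" "hd (concat Ss) = hd (hd Ss)" "hd Ss \<in> set Ss" "hd Ss \<noteq> []"
      using dec(1) False by (cases Ss; auto simp: decreasing_pieces_Cons)+
    have "hd (hd Ss) \<subseteq> \<Union>(set (hd Ss))" "Min (\<Union>(set (hd Ss))) \<in> hd (hd Ss)"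
      using ne(3) hd_in_set[OF ne(4)] dec(1) unfolding decreasing_pieces_def by blast+
    moreover have "finite (\<Union>(set (hd Ss)))"
      using ne(3) osp_Union[OF osps(2)] fin U(1) by (intro finite_subset[OF _ fin]) auto
    ultimately have "Min (hd (hd Ss)) \<le> Min (\<Union>(set (hd Ss)))"
      by (meson Min_le finite_subset)
    \<comment> \<open>The first block of what follows contains the minimum of the next piece, and
      piece minima decrease.\<close>
    then have hdlt: "Min (hd (concat Ss)) < Min UA" using dec(4)[OF ne(3)] ne(2) by simp
    have finUA: "finite UA" using fin U by auto
    have ge: "Min UA \<le> Min a" if "a \<in> set A" for a
    proof -
      have "a \<subseteq> UA" using that by (auto simp: UA_def)
      moreover have "a \<noteq> {}" using that osps(1) by (auto simp: osp_def partition_on_def)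
      ultimately show ?thesis using finUA by (simp add: Min_antimono)
    qed
    let ?G = "{blade n (T # W) |W. osp U W \<and> min_word W < min_word (concat (A # Ss))}"
    have lower: "conv n (blade n (T # A)) (blade n (T # B)) - blade n (T # A @ B) \<in> cfun.span ?G"
      if "osp V B" "min_word B \<le> min_word (concat Ss)" for B
    proof -
      have "V \<noteq> {}" using osps(2) ne(1) by (cases "concat Ss") auto
      with that(1) have "B \<noteq> []" by auto
      then obtain c C where B: "B = c # C" by (cases B) auto
      have "Min c \<le> Min (hd (concat Ss))"
        using that(2) ne(1) unfolding B by (cases "concat Ss") (auto simp: order_le_less)
      then have "Min (hd B) < Min a" if "a \<in> set A" for a
        using hdlt ge[OF that] B by simp
      then show ?thesis
        using conv_blade_lower[OF Cons.prems(1) TU(1,2) U(2) TU(3) osps(1) that(1) _ _ that(2)]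
        by (simp add: B U(1))
    qed
    define X where "X = foldr (\<lambda>A. conv n (blade n (T # A))) Ss (char_fun {0})"
    define b where "b = blade n (T # concat Ss)"
    let ?G' = "{blade n (T # W) |W. osp V W \<and> min_word W < min_word (concat Ss)}"
    have Xb: "X - b \<in> cfun.span ?G'"
      unfolding X_def b_def using Cons.IH[OF Cons.prems(1) TU(2) _ osps(2) False dec(1)] TU(3) by auto
    have bl: "blade n (T # W) \<in> cone_span n" if "osp V W" for W
      using blade_in_cone_span[OF ospT[OF that TU(2)]] TU(3) by auto
    \<comment> \<open>For a lower word \<open>W\<close>, both the leading word \<open>A @ W\<close>
      of the product and its own lower terms lie below \<open>A @ concat Ss\<close>.\<close>
    have "s \<in> cone_span n \<and> conv n (blade n (T # A)) s \<in> cfun.span ?G" if "s \<in> cfun.span ?G'" for s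
      using that
    proof (rule cfun.span_induct_alt)
      show "0 \<in> cone_span n \<and> conv n (blade n (T # A)) 0 \<in> cfun.span ?G"
        by (simp add: cone_span_zero conv_zero_right cfun.span_zero)
    next
      fix c x y
      assume x: "x \<in> ?G'" and y: "y \<in> cone_span n \<and> conv n (blade n (T # A)) y \<in> cfun.span ?G"
      then obtain W where W: "x = blade n (T # W)" "osp V W" "min_word W < min_word (concat Ss)" by blast
      have "osp U (A @ W)" using osps W(2) unfolding osp_append UA_def[symmetric] V_def[symmetric] by blast
      then have "blade n (T # A @ W) \<in> cfun.span ?G"
        using W(3) by (intro cfun.span_base) (auto simp: append_less_append_iff)
      then have "conv n (blade n (T # A)) x \<in> cfun.span ?G"
        using lower[OF W(2)] W(1,3) cfun.span_add[OF lower[OF W(2)] \<open>blade n (T # A @ W) \<in> _\<close>]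
        by (simp only: diff_add_cancel order_less_imp_le)
      moreover have xs: "x \<in> cone_span n" using bl W by simp
      ultimately show "cscale c x + y \<in> cone_span n \<and> conv n (blade n (T # A)) (cscale c x + y) \<in> cfun.span ?G"
        using y bA by (simp only: conv_add_right conv_scale_right cone_span_scale cone_span_add
            cfun.span_add cfun.span_scale simp_thms)
    qed
    from this[OF Xb] have "X - b \<in> cone_span n" "conv n (blade n (T # A)) (X - b) \<in> cfun.span ?G" by auto
    moreover have "b \<in> cone_span n" unfolding b_def by (rule bl[OF osps(2)])
    ultimately have "conv n (blade n (T # A)) X
        = conv n (blade n (T # A)) (X - b) + conv n (blade n (T # A)) b"
      using conv_add_right[of "X - b" n b "blade n (T # A)"] bA by simp
    then have "conv n (blade n (T # A)) X - blade n (T # A @ concat Ss)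
       = conv n (blade n (T # A)) (X - b) + (conv n (blade n (T # A)) b - blade n (T # A @ concat Ss))"
      by (simp only: add_diff_eq)
    also have "\<dots> \<in> cfun.span ?G"
      using \<open>conv n (blade n (T # A)) (X - b) \<in> cfun.span ?G\<close> lower[OF osps(2) order_refl]
      unfolding b_def by (rule cfun.span_add)
    finally show ?thesis by (simp add: X_def)
  qed
qed simp

text \<open>This makes the fold over a set of blades independent of the order of the
  factors.\<close>

lemma comp_fun_commute_on_conv_blade:
  "comp_fun_commute_on {S. \<exists>U\<subseteq>{1..n}. osp U S} (\<lambda>S. conv n (blade n S))"
  by standard (auto simp: fun_eq_iff intro!: conv_left_commute[THEN fun_cong] blade_in_cone_span)

lemma composite_fun_pieces:
  assumes "t \<in> T" "T \<inter> U = {}" "T \<union> U \<subseteq> {1..n}" "osp U (concat Ss)" "decreasing_pieces Ss"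
  shows "composite_fun n ((#) T ` set Ss) = foldr (\<lambda>A. conv n (blade n (T # A))) Ss (char_fun {0})"
  using assms(2-)
proof (induction Ss arbitrary: U)
  case Nil
  then show ?case by (simp add: composite_fun_def)
next
  case (Cons A Ss)
  interpret comp_fun_commute_on "{S. \<exists>U\<subseteq>{1..n}. osp U S}" "\<lambda>S. conv n (blade n S)"
    by (rule comp_fun_commute_on_conv_blade)
  have osps: "osp (\<Union>(set A)) A" "osp (U - \<Union>(set A)) (concat Ss)"
    using Cons.prems(3) by (auto simp: osp_append)
  have ospT: "osp (T \<union> \<Union>(set B)) (T # B)" if B: "B \<in> set (A # Ss)" for B
  proof -
    obtain Xs Ys where "A # Ss = Xs @ B # Ys" using split_list[OF B] by blast
    then have "osp (\<Union>(set B)) B" "\<Union>(set B) \<subseteq> U" using Cons.prems(3) by (auto simp: osp_append)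
    moreover from this have "T \<union> \<Union>(set B) - T = \<Union>(set B)" using Cons.prems(1) by auto
    ultimately show ?thesis using assms(1) by auto
  qed
  have "\<Union>(set B) \<subseteq> U" if "B \<in> set (A # Ss)" for B
    using osp_Union[OF Cons.prems(3)] that by auto
  then have sub: "(#) T ` set (A # Ss) \<subseteq> {S. \<exists>U\<subseteq>{1..n}. osp U S}"
    using ospT Cons.prems(2) by fastforce
  \<comment> \<open>Minima decrease strictly along the list, so no piece is repeated and the set has
    one factor per list entry.\<close>
  have "A \<notin> set Ss" using Cons.prems(4) by (auto simp: decreasing_pieces_Cons)
  then have "T # A \<notin> (#) T ` set Ss" by auto
  then have "composite_fun n ((#) T ` set (A # Ss)) = conv n (blade n (T # A)) (composite_fun n ((#) T ` set Ss))"
    unfolding composite_fun_def using fold_insert[of "T # A" "(#) T ` set Ss"] sub by simp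
  moreover have "composite_fun n ((#) T ` set Ss) = foldr (\<lambda>A. conv n (blade n (T # A))) Ss (char_fun {0})"
    using Cons.prems osps by (intro Cons.IH[of "U - \<Union>(set A)"]) (auto simp: decreasing_pieces_Cons)
  ultimately show ?case by simp
qed

end

section \<open>The map \<open>U_B\<close>\<close>

lemma osp_concat_piece_subset: "osp U (concat Ss) \<Longrightarrow> A \<in> set Ss \<Longrightarrow> \<Union>(set A) \<subseteq> U"
  using osp_Union by fastforce

text \<open>Pieces must be nonempty, as an empty one would contribute an empty block to the coarse
  partition.\<close>

lemma osp_concat:
  assumes "\<And>A. A \<in> set Ss \<Longrightarrow> A \<noteq> []"
  shows "osp U (concat Ss) \<longleftrightarrow>
    osp U (map (\<lambda>S. \<Union>(set S)) Ss) \<and> (\<forall>A\<in>set Ss. osp (\<Union>(set A)) A)"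
  using assms
proof (induction Ss arbitrary: U)
  case (Cons A Ss)
  have "\<Union>(set A) \<noteq> {}" if "osp (\<Union>(set A)) A"
    using that Cons.prems[of A] by (cases A) auto
  then show ?case using Cons by (auto simp: osp_append)
qed simp

context
  fixes T :: "nat set" and Ss :: "nat set list list" and U :: "nat set"
  assumes ospU: "osp U (T # concat Ss)" and fin: "finite U" and dec: "decreasing_pieces Ss"
begin

text \<open>Counts positions in the tail after \<open>T\<close> from 0. Blocks are numbered from 1
  and \<open>T\<close> is block 1, whence the shift by 2 between offsets and cut indices.\<close>

private definition off :: "nat \<Rightarrow> nat" where "off k = length (concat (take k Ss))"

private lemma concat_split:
  "k < length Ss \<Longrightarrow> concat Ss = concat (take k Ss) @ Ss ! k @ concat (drop (Suc k) Ss)"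
  by (metis concat.simps(2) concat_append id_take_nth_drop)

private lemma off_Suc: "k < length Ss \<Longrightarrow> off (Suc k) = off k + length (Ss ! k)"
  by (simp add: off_def take_Suc_conv_app_nth)

private lemma off_length: "off (length Ss) = length (concat Ss)"
  by (simp add: off_def)

private lemma off_le: "off k \<le> length (concat Ss)"
  unfolding off_def using append_take_drop_id[of k Ss] by (metis concat_append length_append le_add1)

private lemma piece_nonempty: "k < length Ss \<Longrightarrow> Ss ! k \<noteq> []"
  using dec by (auto simp: decreasing_pieces_def)

private lemma piece_hd: "k < length Ss \<Longrightarrow> hd (Ss ! k) = concat Ss ! off k"
  using concat_split[of k] piece_nonempty[of k] by (simp add: off_def nth_append hd_conv_nth)

private lemma block_tail: "2 \<le> j \<Longrightarrow> block (T # concat Ss) j = concat Ss ! (j - 2)"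
  by (auto simp: block_def nth_Cons' numeral_2_eq_2)

private lemma take_off: "k \<le> length Ss \<Longrightarrow> take (off k) (concat Ss) = concat (take k Ss)"
  unfolding off_def by (metis append_eq_conv_conj append_take_drop_id concat_append)

private lemma Union_blocks:
  assumes "b \<le> length (concat Ss)"
  shows "(\<Union>l\<in>{2..<2 + b}. block (T # concat Ss) l) = \<Union>(set (take b (concat Ss)))"
proof -
  have "(\<Union>l\<in>{2..<2 + b}. block (T # concat Ss) l) = (\<Union>l\<in>{2..<2 + b}. concat Ss ! (l - 2))"
    by (intro SUP_cong) (auto simp: block_tail)
  also have "\<dots> = (\<Union>l\<in>{..<b}. concat Ss ! l)"
  proof -
    have "{2..<2 + b} = (\<lambda>l. l + 2) ` {..<b}"
      using image_add_atLeastLessThan'[of 2 0 b] by (simp only: lessThan_atLeast0 add.commute[of _ 2] add_0_right)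
    then show ?thesis by simp
  qed
  also have "\<dots> = \<Union>(set (take b (concat Ss)))"
    using assms by (simp add: nth_image[symmetric] atLeast0LessThan)
  finally show ?thesis .
qed

text \<open>Piece minima decrease from left to right, so the last piece of an initial segment holds
  the minimum of the segment.\<close>

private lemma Min_pieces:
  assumes "k < length Ss"
  shows "Min (\<Union>(set (concat (take (Suc k) Ss)))) = Min (\<Union>(set (Ss ! k)))"
proof (rule Min_eqI)
  have osp: "osp (U - T) (concat Ss)" using ospU by simp
  have sub: "\<Union>(set A) \<subseteq> U" if "A \<in> set Ss" for A
    using osp_concat_piece_subset[OF osp that] by auto
  have f: "finite (\<Union>(set A))" if "A \<in> set Ss" for A
    using sub[OF that] fin finite_subset by blast
  have tk: "take (Suc k) Ss = take k Ss @ [Ss ! k]" using assms by (simp add: take_Suc_conv_app_nth)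
  show "finite (\<Union>(set (concat (take (Suc k) Ss))))"
    using fin sub by (intro finite_subset[OF _ fin]) (auto dest!: in_set_takeD)
  have ne: "A \<in> set Ss \<Longrightarrow> \<Union>(set A) \<noteq> {}" for A
    using dec hd_in_set[of A] unfolding decreasing_pieces_def by blast
  show "Min (\<Union>(set (Ss ! k))) \<in> \<Union>(set (concat (take (Suc k) Ss)))"
    using Min_in[OF f ne] assms by (auto simp: tk)
  fix y assume "y \<in> \<Union>(set (concat (take (Suc k) Ss)))"
  then obtain l where l: "l \<le> k" "y \<in> \<Union>(set (Ss ! l))"
  proof -
    from \<open>y \<in> _\<close> obtain A where A: "A \<in> set (take (Suc k) Ss)" "y \<in> \<Union>(set A)" by auto
    from A(1) obtain l where "l < Suc k" "A = Ss ! l" by (auto simp: in_set_conv_nth)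
    with A(2) show ?thesis using that[of l] by simp
  qed
  have "Min (\<Union>(set (Ss ! k))) \<le> Min (\<Union>(set (Ss ! l)))"
    using l(1) assms dec by (cases "l = k") (auto simp: decreasing_pieces_def sorted_wrt_iff_nth_less less_imp_le)
  also have "\<dots> \<le> y" using l assms f[of "Ss ! l"] by (intro Min_le) auto
  finally show "Min (\<Union>(set (Ss ! k))) \<le> y" .
qed

text \<open>Cuts are made from the right, pieces are numbered from the left starting at 0: the cut
  \<open>p\<close> falls at the start of piece \<open>length Ss - p\<close>, and for
  \<open>p = 0\<close> just past the end.\<close>

private lemma cut_index_pieces:
  "p \<le> length Ss \<Longrightarrow> cut_index (T # concat Ss) p = 2 + off (length Ss - p)"
proof (induction p)
  case 0
  then show ?case by (simp add: off_length)
next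
  case (Suc p)
  define k where "k = length Ss - Suc p"
  have k: "k < length Ss" "length Ss - p = Suc k" using Suc.prems by (auto simp: k_def)
  have IH: "cut_index (T # concat Ss) p = 2 + off (Suc k)" using Suc k by simp
  define M where "M = Min (\<Union>(set (Ss ! k)))"
  have "M \<in> hd (Ss ! k)" using dec k(1) by (auto simp: decreasing_pieces_def M_def)
  then have M: "M \<in> concat Ss ! off k" by (simp add: piece_hd[OF k(1)])
  have lt: "off k < off (Suc k)" using off_Suc[OF k(1)] piece_nonempty[OF k(1)] by simp
  have "Min (\<Union>l\<in>{2..<2 + off (Suc k)}. block (T # concat Ss) l) = M"
    using Union_blocks[OF off_le, of "Suc k"] take_off[of "Suc k"] Min_pieces[OF k(1)] k(1)
    by (simp add: M_def del: concat.simps take_Suc)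
  then have "cut_index (T # concat Ss) (Suc p) =
      (THE j. j \<in> {2..<2 + off (Suc k)} \<and> M \<in> block (T # concat Ss) j)"
    using IH by simp
  also have "\<dots> = 2 + off k"
  proof (rule the_equality)
    show "2 + off k \<in> {2..<2 + off (Suc k)} \<and> M \<in> block (T # concat Ss) (2 + off k)"
      using lt M by (simp add: block_tail)
  next
    fix j assume j: "j \<in> {2..<2 + off (Suc k)} \<and> M \<in> block (T # concat Ss) j"
    then have "M \<in> concat Ss ! (j - 2)" by (auto simp: block_tail)
    moreover have "j - 2 < length (concat Ss)" "off k < length (concat Ss)"
      using j lt off_le[of "Suc k"] by auto
    ultimately have "j - 2 = off k" using osp_nth_unique[of "U - T"] ospU M by auto
    then show "j = 2 + off k" using j by auto
  qed
  finally show ?case by (simp add: k_def)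
qed

text \<open>Pieces are nonempty, so the offset 0 is reached at piece 0 and not at a later
  one.\<close>

private lemma cut_count_pieces: "cut_count (T # concat Ss) = length Ss"
  unfolding cut_count_def
proof (rule Least_equality)
  show "cut_index (T # concat Ss) (length Ss) = 2" by (simp add: cut_index_pieces off_def)
next
  fix p assume p: "cut_index (T # concat Ss) p = 2"
  show "length Ss \<le> p"
  proof (rule ccontr)
    assume "\<not> length Ss \<le> p"
    then obtain k where k: "length Ss - p = Suc k" "k < length Ss" by (cases "length Ss - p") auto
    then have "off (Suc k) = 0" using p cut_index_pieces[of p] \<open>\<not> length Ss \<le> p\<close> by simp
    then show False using off_Suc[OF k(2)] piece_nonempty[OF k(2)] by simp
  qed
qed

private lemma map_block_piece:
  assumes "k < length Ss"
  shows "map (block (T # concat Ss)) [2 + off k..<2 + off (Suc k)] = Ss ! k"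
proof (rule nth_equalityI)
  show len: "length (map (block (T # concat Ss)) [2 + off k..<2 + off (Suc k)]) = length (Ss ! k)"
    by (simp only: length_map length_upt off_Suc[OF assms])
  fix i assume i': "i < length (map (block (T # concat Ss)) [2 + off k..<2 + off (Suc k)])"
  then have i: "i < length (Ss ! k)" by (simp only: len)
  have "[2 + off k..<2 + off (Suc k)] ! i = 2 + off k + i"
    using i by (intro nth_upt) (simp only: off_Suc[OF assms])
  then have "map (block (T # concat Ss)) [2 + off k..<2 + off (Suc k)] ! i = concat Ss ! (off k + i)"
    using i' block_tail[of "2 + off k + i"] by (simp only: nth_map length_map) simp
  also have "\<dots> = Ss ! k ! i"
    using i by (subst concat_split[OF assms]) (simp add: off_def nth_append)
  finally show "map (block (T # concat Ss)) [2 + off k..<2 + off (Suc k)] ! i = Ss ! k ! i" .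
qed

lemma U_B_pieces:
  assumes "Ss \<noteq> []"
  shows "U_B (T # concat Ss) = (#) T ` set Ss"
proof -
  let ?S = "T # concat Ss"
  let ?piece = "\<lambda>p. map (block ?S) [cut_index ?S p..<cut_index ?S (p - 1)]"
  have "concat Ss \<noteq> []" using assms piece_nonempty[of 0] by (cases Ss) auto
  then have len: "length ?S \<noteq> 1"
    by (metis One_nat_def Suc_inject length_0_conv length_Cons)
  have "U_B ?S = {block ?S 1 # ?piece p |p. p \<in> {1..length Ss}}"
    unfolding U_B_def cut_count_pieces if_not_P[OF len] ..
  also have "\<dots> = {T # Ss ! (length Ss - p) |p. p \<in> {1..length Ss}}"
  proof -
    have "?piece p = Ss ! (length Ss - p)" if "p \<in> {1..length Ss}" for p
    proof -
      have "length Ss - (p - 1) = Suc (length Ss - p)" "length Ss - p < length Ss"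
        "p \<le> length Ss" "p - 1 \<le> length Ss" using that by auto
      then show ?thesis by (simp only: cut_index_pieces map_block_piece)
    qed
    moreover have "block ?S 1 = T" by (simp add: block_def)
    ultimately show ?thesis unfolding Setcompr_eq_image by (intro image_cong) simp_all
  qed
  also have "\<dots> = (#) T ` set Ss"
  proof (intro set_eqI iffI)
    fix X assume "X \<in> {T # Ss ! (length Ss - p) |p. p \<in> {1..length Ss}}"
    then show "X \<in> (#) T ` set Ss" by auto
  next
    fix X assume "X \<in> (#) T ` set Ss"
    then obtain k where k: "k < length Ss" "X = T # Ss ! k" by (auto simp: in_set_conv_nth)
    then show "X \<in> {T # Ss ! (length Ss - p) |p. p \<in> {1..length Ss}}"
      by (auto intro!: exI[of _ "length Ss - k"])
  qed
  finally show ?thesis .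
qed

end

text \<open>The last piece starts at the block that contains the overall minimum. The blocks before
  it are split recursively, and their minima are all larger.\<close>

lemma ex_decreasing_pieces:
  assumes "osp U L" "finite U"
  shows "\<exists>Ss. concat Ss = L \<and> decreasing_pieces Ss"
  using assms
proof (induction "length L" arbitrary: L U rule: less_induct)
  case less
  show ?case
  proof (cases "L = []")
    case True
    then show ?thesis by (intro exI[of _ "[]"]) (simp add: decreasing_pieces_def)
  next
    case False
    then have "U \<noteq> {}" using less.prems(1) by (cases L) auto
    then have "Min U \<in> \<Union>(set L)" using less.prems by (simp add: osp_Union)
    then obtain i where i: "i < length L" "Min U \<in> L ! i" by (auto simp: in_set_conv_nth)
    define V where "V = \<Union>(set (take i L))"
    have osps: "osp V (take i L)" "V \<subseteq> U" "osp (U - V) (drop i L)"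
      using less.prems(1) osp_append[of U "take i L" "drop i L"] by (auto simp: V_def)
    have "finite V" using osps(2) less.prems(2) finite_subset by blast
    then obtain Ss where Ss: "concat Ss = take i L" "decreasing_pieces Ss"
      using less.hyps[of "take i L"] osps(1) i(1) by auto
    have hd: "hd (drop i L) = L ! i" using i by (simp add: hd_drop_conv_nth)
    have Ud: "\<Union>(set (drop i L)) = U - V" using osp_Union[OF osps(3)] .
    have "L ! i \<in> set (drop i L)" using i hd by (metis drop_eq_Nil hd_in_set not_le)
    then have MV: "Min U \<in> U - V" using i(2) Ud by blast
    then have MinUV: "Min (U - V) = Min U"
      using less.prems(2) by (intro Min_eqI) auto
    have "Min U < Min (\<Union>(set A))" if "A \<in> set Ss" for A
    proof -
      have "set A \<subseteq> set (take i L)" unfolding Ss(1)[symmetric] using that by auto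
      then have sub: "\<Union>(set A) \<subseteq> V" unfolding V_def by (rule Union_mono)
      have "A \<noteq> []" "Min (\<Union>(set A)) \<in> hd A" using that Ss(2) by (auto simp: decreasing_pieces_def)
      then have "Min (\<Union>(set A)) \<in> V" using sub hd_in_set[of A] by blast
      then have "Min (\<Union>(set A)) \<in> U" "Min (\<Union>(set A)) \<noteq> Min U" using osps(2) MV by auto
      then show ?thesis using less.prems(2) by (simp add: order_less_le)
    qed
    then have "decreasing_pieces (Ss @ [drop i L])"
      using Ss(2) i hd Ud MinUV by (auto simp: decreasing_pieces_def sorted_wrt_append)
    moreover have "concat (Ss @ [drop i L]) = L" by (simp add: Ss(1))
    ultimately show ?thesis by blast
  qed
qed

lemma standard_osp_cases:
  assumes "standard_osp {1..n} S" "n \<ge> 1"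
  obtains T Ss where "S = T # concat Ss" "1 \<in> T" "decreasing_pieces Ss"
    "osp ({1..n} - T) (concat Ss)" "T \<subseteq> {1..n}"
proof -
  obtain T L where S: "S = T # L" using assms(1) by (cases S) (auto simp: standard_osp_def)
  have "Min {1..n} = 1" using assms(2) by (intro Min_eqI) auto
  then have T: "1 \<in> T" "T \<subseteq> {1..n}" "osp ({1..n} - T) L"
    using assms(1) by (auto simp: standard_osp_def S)
  obtain Ss where "concat Ss = L" "decreasing_pieces Ss"
    using ex_decreasing_pieces[OF T(3)] by auto
  then show thesis using that[of T Ss] T S by auto
qed

lemma U_B_single: "U_B [T] = {[T]}"
  by (simp add: U_B_def)

lemma composite_osp_pieces:
  assumes T: "1 \<in> T" "T \<subseteq> {1..n}" and osp: "osp ({1..n} - T) (concat Ss)"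
    and dec: "decreasing_pieces Ss"
  shows "composite_osp n (if Ss = [] then {[T]} else (#) T ` set Ss)"
proof -
  have ne: "A \<noteq> []" if "A \<in> set Ss" for A using dec that by (auto simp: decreasing_pieces_def)
  have o: "osp ({1..n} - T) (map (\<lambda>S. \<Union>(set S)) Ss)" "\<And>A. A \<in> set Ss \<Longrightarrow> osp (\<Union>(set A)) A"
    using osp osp_concat[OF ne] by auto
  have "two_standard_osp (T \<union> \<Union>(set A)) (T # A)" if A: "A \<in> set Ss" for A
  proof -
    have sub: "\<Union>(set A) \<subseteq> {1..n} - T" using osp_concat_piece_subset[OF osp A] .
    then have fin: "finite (T \<union> \<Union>(set A))" using T(2) finite_subset[of "T \<union> \<Union>(set A)" "{1..n}"] by auto
    have "Min (T \<union> \<Union>(set A)) = 1"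
      using T sub fin by (intro Min_eqI) (auto simp: subset_iff)
    moreover have "T \<union> \<Union>(set A) - T = \<Union>(set A)" using sub by auto
    moreover have "Min (\<Union>(set A)) \<in> hd A" using dec A by (auto simp: decreasing_pieces_def)
    ultimately show ?thesis using T o(2)[OF A] ne[OF A]
      by (auto simp: two_standard_osp_def standard_osp_def)
  qed
  then show ?thesis unfolding composite_osp_def using T o
    by (intro exI[of _ T] exI[of _ Ss]) auto
qed

text \<open>Surjectivity of \<open>U_B\<close>: concatenating the pieces in decreasing order of
  their minima gives a list that \<open>U_B\<close> cuts back into the same pieces.\<close>

lemma composite_osp_cases:
  assumes "composite_osp n C" "n \<ge> 1"
  obtains S where "standard_osp {1..n} S" "U_B S = C"
proof -
  have Min1: "Min {1..n} = 1" using assms(2) by (intro Min_eqI) auto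
  obtain T Ss where T: "1 \<in> T" and osp: "osp {1..n} (T # map (\<lambda>S. \<Union>(set S)) Ss)"
    and Ss: "\<And>S. S \<in> set Ss \<Longrightarrow> osp (\<Union>(set S)) S \<and> two_standard_osp (T \<union> \<Union>(set S)) (T # S)"
    and C: "C = (if Ss = [] then {[T]} else (#) T ` set Ss)"
    using assms(1) unfolding composite_osp_def by blast
  show thesis
  proof (cases "Ss = []")
    case True
    then have "standard_osp {1..n} [T]" using T osp Min1 by (auto simp: standard_osp_def)
    then show thesis using that[of "[T]"] True C by (simp add: U_B_single)
  next
    case False
    define m where "m S = Min (\<Union>(set S))" for S :: "nat set list"
    define Ss' where "Ss' = rev (sort_key m Ss)"
    have set': "set Ss' = set Ss" by (simp add: Ss'_def)
    have osp': "osp ({1..n} - T) (map (\<lambda>S. \<Union>(set S)) Ss)" using osp by simp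
    have sub: "\<Union>(set A) \<subseteq> {1..n} - T" if "A \<in> set Ss" for A
      using osp_Union[OF osp'] that by auto
    have ne: "\<Union>(set A) \<noteq> {}" if "A \<in> set Ss" for A
    proof -
      have "{} \<notin> (\<lambda>S. \<Union>(set S)) ` set Ss" using osp' by (simp add: osp_def partition_on_def)
      then show ?thesis using that by (metis imageI)
    qed
    have min_in: "m A \<in> \<Union>(set A)" if "A \<in> set Ss" for A
      unfolding m_def using finite_subset[OF sub[OF that]] ne[OF that] by (intro Min_in) blast+
    have dist: "distinct Ss" using osp' by (auto simp: osp_def distinct_map)
    have inj: "A = B" if "A \<in> set Ss" "B \<in> set Ss" "m A = m B" for A B
    proof -
      have d: "disjoint ((\<lambda>S. \<Union>(set S)) ` set Ss)" and i: "inj_on (\<lambda>S. \<Union>(set S)) (set Ss)"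
        using osp' by (auto simp: osp_def partition_on_def distinct_map)
      have "\<Union>(set A) \<inter> \<Union>(set B) \<noteq> {}"
        using that(3) min_in[OF that(1)] min_in[OF that(2)] by (metis disjoint_iff)
      then have "\<Union>(set A) = \<Union>(set B)"
        using disjointD[OF d imageI[OF that(1)] imageI[OF that(2)]] by blast
      then show ?thesis by (rule inj_onD[OF i]) (use that in simp_all)
    qed
    \<comment> \<open>Distinct pieces are disjoint and nonempty, so their minima differ and the
      sorting is strict.\<close>
    have "sorted_wrt (\<lambda>A B. m A < m B) (sort_key m Ss)"
    proof -
      have "sorted (map m (sort_key m Ss))" by simp
      moreover have "distinct (map m (sort_key m Ss))"
        using dist inj by (auto simp: distinct_map inj_on_def)
      ultimately have "sorted_wrt (<) (map m (sort_key m Ss))"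
        by (simp add: strict_sorted_iff)
      then show ?thesis by (simp add: sorted_wrt_map)
    qed
    moreover have "A \<noteq> [] \<and> m A \<in> hd A" if A: "A \<in> set Ss" for A
    proof -
      have "A \<noteq> []" using ne[OF A] by auto
      moreover have "T \<union> \<Union>(set A) - T = \<Union>(set A)" using sub[OF A] by auto
      ultimately show ?thesis using Ss[OF A] by (auto simp: two_standard_osp_def standard_osp_def m_def)
    qed
    ultimately have dec: "decreasing_pieces Ss'"
      unfolding decreasing_pieces_def set' m_def[symmetric] by (simp add: Ss'_def sorted_wrt_rev)
    have "osp ({1..n} - T) (map (\<lambda>S. \<Union>(set S)) Ss')"
      using osp' set' by (auto simp: osp_def distinct_map Ss'_def)
    then have "osp ({1..n} - T) (concat Ss')"
      using osp_concat[of Ss' "{1..n} - T"] dec Ss set' by (auto simp: decreasing_pieces_def)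
    then have ospS: "osp {1..n} (T # concat Ss')" using osp by simp
    then have "standard_osp {1..n} (T # concat Ss')" using T Min1 by (simp add: standard_osp_def)
    moreover have "U_B (T # concat Ss') = C"
    proof -
      have "Ss' \<noteq> []" using False set' by (metis set_empty)
      then show ?thesis using U_B_pieces[OF ospS _ dec] False by (simp add: C set')
    qed
    ultimately show thesis using that by blast
  qed
qed

lemma composite_osp_U_B:
  assumes "standard_osp {1..n} S" "n \<ge> 1"
  shows "composite_osp n (U_B S)"
proof -
  obtain T Ss where S: "S = T # concat Ss" "1 \<in> T" "decreasing_pieces Ss"
    "osp ({1..n} - T) (concat Ss)" "T \<subseteq> {1..n}" using standard_osp_cases[OF assms] by blast
  have osp: "osp {1..n} (T # concat Ss)" using S by auto
  have "U_B S = (if Ss = [] then {[T]} else (#) T ` set Ss)"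
    using U_B_pieces[OF osp _ S(3)] by (simp add: S(1) U_B_single)
  then show ?thesis using composite_osp_pieces[OF S(2,5,4,3)] by simp
qed

text \<open>All words that occur share the first block \<open>T\<close>, which contains 1; prefixing
  it turns lower words of the tail into lower standard partitions.\<close>

lemma composite_fun_U_B:
  assumes "standard_osp {1..n} S" "n \<ge> 1"
  shows "composite_fun n (U_B S) - blade n S
    \<in> cfun.span {blade n S' |S'. standard_osp {1..n} S' \<and> min_word S' < min_word S}"
proof -
  obtain T Ss where S: "S = T # concat Ss" "1 \<in> T" "decreasing_pieces Ss"
    "osp ({1..n} - T) (concat Ss)" "T \<subseteq> {1..n}" using standard_osp_cases[OF assms] by blast
  have osp: "osp {1..n} (T # concat Ss)" using S by auto
  have Min1: "Min {1..n} = 1" using assms(2) by (intro Min_eqI) auto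
  show ?thesis
  proof (cases "Ss = []")
    case True
    interpret comp_fun_commute_on "{S. \<exists>U\<subseteq>{1..n}. osp U S}" "\<lambda>S. conv n (blade n S)"
      by (rule comp_fun_commute_on_conv_blade)
    have "composite_fun n {S} = conv n (blade n S) (char_fun {0})"
      unfolding composite_fun_def using fold_insert[of S "{}"] osp S(1) by auto
    also have "\<dots> = blade n S"
      using osp S(1) by (intro conv_zero_cone blade_in_cone_span[of "{1..n}"]) auto
    finally have "composite_fun n (U_B S) = blade n S"
      using True S(1) by (simp add: U_B_single)
    then show ?thesis by (simp only: diff_self cfun.span_zero)
  next
    case False
    have TU: "T \<inter> ({1..n} - T) = {}" "T \<union> ({1..n} - T) \<subseteq> {1..n}" using S(5) by auto
    have "composite_fun n (U_B S) - blade n S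
      \<in> cfun.span {blade n (T # W) |W. osp ({1..n} - T) W \<and> min_word W < min_word (concat Ss)}"
      using conv_pieces_leading_term[OF S(2) TU S(4) False S(3)]
        composite_fun_pieces[OF S(2) TU S(4,3)] U_B_pieces[OF osp _ S(3) False] S(1) by simp
    moreover have "{blade n (T # W) |W. osp ({1..n} - T) W \<and> min_word W < min_word (concat Ss)}
      \<subseteq> {blade n S' |S'. standard_osp {1..n} S' \<and> min_word S' < min_word S}"
    proof (intro subsetI, elim CollectE exE conjE)
      fix x W assume "x = blade n (T # W)" "osp ({1..n} - T) W" "min_word W < min_word (concat Ss)"
      then show "x \<in> {blade n S' |S'. standard_osp {1..n} S' \<and> min_word S' < min_word S}"
        using S(1,2,5) Min1 by (intro CollectI exI[of _ "T # W"]) (auto simp: standard_osp_def)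
    qed
    ultimately show ?thesis using cfun.span_mono by blast
  qed
qed

section \<open>Linear independence\<close>

definition dual_halfspace :: "nat \<Rightarrow> vec \<Rightarrow> vec set" where
  "dual_halfspace n y = {x \<in> V0 n. 0 \<le> (\<Sum>i=1..n. y i * x i)}"

lemma polyhedral_cone_dual_halfspace: "polyhedral_cone n (dual_halfspace n y)"
  unfolding polyhedral_cone_def dual_halfspace_def by (intro exI[of _ "{y}"]) simp

lemma polyhedral_cone_scale:
  assumes "polyhedral_cone n C" "x \<in> C" "0 \<le> c"
  shows "(\<lambda>i. c * x i) \<in> C"
proof -
  obtain A where C: "C = {x \<in> V0 n. \<forall>a\<in>A. 0 \<le> (\<Sum>i=1..n. a i * x i)}"
    using assms(1) unfolding polyhedral_cone_def by blast
  have "(\<Sum>i=1..n. a i * (c * x i)) = c * (\<Sum>i=1..n. a i * x i)" for a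
    by (simp add: sum_distrib_left mult_ac)
  moreover have "(\<lambda>i. c * x i) \<in> V0 n"
    using assms(2) by (auto simp: C V0_def sum_distrib_left[symmetric])
  ultimately show ?thesis using assms(2,3) unfolding C by simp
qed

lemma polyhedral_cone_zero: "polyhedral_cone n C \<Longrightarrow> 0 \<in> C"
  by (auto simp: polyhedral_cone_def V0_def)

text \<open>If \<open>C\<close> has a point outside the half-space, the sum fills
  \<open>V0 n\<close>; otherwise it stays inside the half-space and misses \<open>z\<close>.\<close>

lemma plus_dual_halfspace:
  assumes C: "polyhedral_cone n C" and z: "z \<in> V0 n" "z \<notin> dual_halfspace n y"
  shows "z \<in> C + dual_halfspace n y \<longleftrightarrow> \<not> C \<subseteq> dual_halfspace n y"
proof -
  define pairing where "pairing x = (\<Sum>i=1..n. y i * x i)" for x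
  have add: "pairing (p + q) = pairing p + pairing q" for p q by (simp add: pairing_def sum.distrib algebra_simps)
  have D: "x \<in> dual_halfspace n y \<longleftrightarrow> 0 \<le> pairing x" if "x \<in> V0 n" for x
    using that by (simp add: dual_halfspace_def pairing_def)
  have z0: "pairing z < 0" using z D by force
  show ?thesis
  proof
    assume "z \<in> C + dual_halfspace n y"
    then obtain p d where pd: "p \<in> C" "d \<in> dual_halfspace n y" "z = p + d" by (auto elim: set_plus_elim)
    have "0 \<le> pairing d" using pd(2) by (simp add: dual_halfspace_def pairing_def)
    then have "pairing p < 0" using z0 by (simp add: pd(3) add)
    then show "\<not> C \<subseteq> dual_halfspace n y"
      using pd(1) by (auto simp: dual_halfspace_def pairing_def)
  next
    assume "\<not> C \<subseteq> dual_halfspace n y"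
    then obtain p where p: "p \<in> C" "p \<notin> dual_halfspace n y" by blast
    have "pairing p < 0" using p D polyhedral_cone_support[OF C p(1)] by force
    \<comment> \<open>The positive multiple of \<open>p\<close> that pairs with \<open>y\<close> as
      \<open>z\<close> does, so that \<open>z - q\<close> lies on the bounding hyperplane.\<close>
    define q where "q = (\<lambda>i. pairing z / pairing p * p i)"
    have q: "q \<in> C" unfolding q_def
      using z0 \<open>pairing p < 0\<close> by (intro polyhedral_cone_scale[OF C p(1)]) (simp add: divide_nonpos_neg)
    have "pairing (\<lambda>i. c * p i) = c * pairing p" for c
      unfolding pairing_def sum_distrib_left by (intro sum.cong) auto
    then have "pairing q = pairing z / pairing p * pairing p" unfolding q_def .
    then have "pairing q = pairing z" using \<open>pairing p < 0\<close> by simp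
    then have "pairing (z - q) = 0" using add[of "z - q" q] by simp
    moreover have "z - q \<in> V0 n" using z(1) polyhedral_cone_support[OF C q] by (rule V0_diff)
    ultimately have "z - q \<in> dual_halfspace n y" using D by simp
    with q have "q + (z - q) \<in> C + dual_halfspace n y" by (rule set_plus_intro)
    then show "z \<in> C + dual_halfspace n y" by simp
  qed
qed

text \<open>Polarity is compatible with linear relations: convolution with a half-space detects whether
  the half-space contains a cone.\<close>

lemma dual_relation:
  fixes c :: "'i \<Rightarrow> complex"
  assumes C: "\<And>i. i \<in> I \<Longrightarrow> polyhedral_cone n (C i)"
    and zero: "(\<Sum>i\<in>I. cscale (c i) (char_fun (C i))) = 0"
  shows "(\<Sum>i\<in>I. c i * of_bool (C i \<subseteq> dual_halfspace n y)) = 0"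
proof -
  let ?D = "dual_halfspace n y"
  have "(\<Sum>i\<in>I. c i * of_bool (\<not> C i \<subseteq> ?D)) = 0"
  proof (cases "\<exists>z\<in>V0 n. z \<notin> ?D")
    case True
    then obtain z where z: "z \<in> V0 n" "z \<notin> ?D" by blast
    have "0 = conv n (\<Sum>i\<in>I. cscale (c i) (char_fun (C i))) (char_fun ?D)"
      by (simp only: zero conv_zero_left)
    also have "\<dots> = (\<Sum>i\<in>I. conv n (cscale (c i) (char_fun (C i))) (char_fun ?D))"
      by (intro conv_sum_left cone_span_scale cone_span_char C polyhedral_cone_dual_halfspace)
    also have "\<dots> = (\<Sum>i\<in>I. cscale (c i) (char_fun (C i + ?D)))"
      by (intro sum.cong refl)
        (simp only: conv_scale_left conv_char cone_span_char C polyhedral_cone_dual_halfspace)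
    finally have "(\<Sum>i\<in>I. cscale (c i) (char_fun (C i + ?D))) z = 0" by simp
    then have "(\<Sum>i\<in>I. c i * indicator (C i + ?D) z) = 0" by (simp only: sum_cscale_apply)
    moreover have "(\<Sum>i\<in>I. c i * indicator (C i + ?D) z) = (\<Sum>i\<in>I. c i * of_bool (\<not> C i \<subseteq> ?D))"
      by (intro sum.cong) (simp_all add: indicator_def plus_dual_halfspace[OF C z])
    ultimately show ?thesis by simp
  next
    case False
    then have "C i \<subseteq> ?D" if "i \<in> I" for i using polyhedral_cone_support[OF C[OF that]] by blast
    then show ?thesis by simp
  qed
  \<comment> \<open>Every cone contains 0, so the relation at 0 gives the sum of all coefficients,
    which allows passing from the cones not contained in the half-space to those contained.\<close>
  moreover have "(\<Sum>i\<in>I. c i) = 0"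
  proof -
    have "(\<Sum>i\<in>I. c i * char_fun (C i) 0) = 0"
      using fun_cong[OF zero, of 0] by (simp only: sum_cscale_apply zero_fun_apply)
    then show ?thesis using polyhedral_cone_zero[OF C] by simp
  qed
  moreover have "(\<Sum>i\<in>I. c i * of_bool (C i \<subseteq> ?D))
      = (\<Sum>i\<in>I. c i) - (\<Sum>i\<in>I. c i * of_bool (\<not> C i \<subseteq> ?D))"
    unfolding sum_subtractf[symmetric] by (intro sum.cong) auto
  ultimately show ?thesis by simp
qed

text \<open>The sum of the functionals defining the plate of a partition of \<open>{1..n}\<close>,
  hence a point in the relative interior of its polar cone. It takes the values
  \<open>length W - 1\<close> down to 0 on successive blocks.\<close>

definition block_weight :: "nat set list \<Rightarrow> vec" where
  "block_weight W i = (\<Sum>j\<in>{1..<length W}. of_bool (i \<in> \<Union>(set (take j W))))"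

lemma plate_subset_block_weight:
  assumes "osp {1..n} W"
  shows "plate n W \<subseteq> dual_halfspace n (block_weight W)"
proof
  fix x assume x: "x \<in> plate n W"
  have "(\<Sum>i=1..n. block_weight W i * x i)
      = (\<Sum>j\<in>{1..<length W}. \<Sum>i=1..n. of_bool (i \<in> \<Union>(set (take j W))) * x i)"
    unfolding block_weight_def sum_distrib_right by (rule sum.swap)
  also have "\<dots> = (\<Sum>j\<in>{1..<length W}. \<Sum>i\<in>\<Union>(set (take j W)). x i)"
  proof (rule sum.cong[OF refl])
    fix j
    have sub: "\<Union>(set (take j W)) \<subseteq> {1..n}"
      using assms osp_append[of "{1..n}" "take j W" "drop j W"] by simp
    have "(\<Sum>i=1..n. of_bool (i \<in> \<Union>(set (take j W))) * x i)
        = (\<Sum>i\<in>\<Union>(set (take j W)). of_bool (i \<in> \<Union>(set (take j W))) * x i)"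
      using sub by (intro sum.mono_neutral_right) auto
    then show "(\<Sum>i=1..n. of_bool (i \<in> \<Union>(set (take j W))) * x i) = (\<Sum>i\<in>\<Union>(set (take j W)). x i)"
      by simp
  qed
  also have "0 \<le> \<dots>" by (rule sum_nonneg) (use x in \<open>simp add: plate_def\<close>)
  finally show "x \<in> dual_halfspace n (block_weight W)"
    using x by (simp add: dual_halfspace_def plate_def)
qed

lemma in_Union_take_iff:
  assumes "osp U W" "a < length W" "i \<in> W ! a"
  shows "i \<in> \<Union>(set (take k W)) \<longleftrightarrow> a < k"
proof
  assume "i \<in> \<Union>(set (take k W))"
  then obtain b where "b < length W" "b < k" "i \<in> W ! b" by (auto simp: in_set_conv_nth)
  then show "a < k" using osp_nth_unique[OF assms(1,2) _ assms(3)] by blast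
next
  assume "a < k"
  then have "W ! a \<in> set (take k W)" using assms(2) by (auto simp: in_set_conv_nth intro!: exI[of _ a])
  then show "i \<in> \<Union>(set (take k W))" using assms(3) by blast
qed

lemma block_weight_nth:
  assumes "osp U W" "a < length W" "i \<in> W ! a"
  shows "block_weight W i = real (length W - Suc a)"
proof -
  have "block_weight W i = (\<Sum>j\<in>{1..<length W}. of_bool (a < j))"
    unfolding block_weight_def in_Union_take_iff[OF assms] ..
  also have "\<dots> = real (card ({1..<length W} \<inter> {j. a < j}))" by (simp add: sum_of_bool_eq)
  also have "{1..<length W} \<inter> {j. a < j} = {Suc a..<length W}" by auto
  finally show ?thesis by simp
qed

text \<open>These vectors test whether a plate lies in a half-space: pairing with the normal
  \<open>y\<close> gives \<open>y i \<ge> y j\<close>.\<close>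

lemma root_in_plate:
  assumes V: "osp {1..n} V" and ab: "a \<le> b" "b < length V" and ij: "i \<in> V ! a" "j \<in> V ! b"
  shows "(\<lambda>k. of_bool (k = i) - of_bool (k = j)) \<in> plate n V"
proof -
  let ?x = "\<lambda>k. of_bool (k = i) - of_bool (k = j) :: real"
  have a: "a < length V" using ab by simp
  have UV: "\<Union>(set V) = {1..n}" using osp_Union[OF V] .
  have ijn: "i \<in> {1..n}" "j \<in> {1..n}" unfolding UV[symmetric] using a ab ij nth_mem by blast+
  have sum: "(\<Sum>k\<in>X. ?x k) = of_bool (i \<in> X) - of_bool (j \<in> X)" if "finite X" for X
    using that by (simp add: sum_subtractf of_bool_def)
  have "?x \<in> V0 n" unfolding V0_def using ijn sum[of "{1..n}"] by auto
  moreover have "0 \<le> (\<Sum>k\<in>\<Union>(set (take l V)). ?x k)" for l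
  proof -
    have "finite (\<Union>(set (take l V)))"
      using V osp_append[of "{1..n}" "take l V" "drop l V"] finite_subset[of _ "{1..n}"] by simp
    then show ?thesis
      unfolding sum[OF \<open>finite (\<Union>(set (take l V)))\<close>] in_Union_take_iff[OF V a ij(1)]
        in_Union_take_iff[OF V ab(2) ij(2)] using ab(1) by auto
  qed
  ultimately show ?thesis unfolding plate_def UV using ijn by auto
qed

text \<open>The order of elements given by the blocks of \<open>V\<close> is weakly respected by
  \<open>W\<close>, so \<open>V\<close> refines \<open>W\<close>; a refinement that is not longer is
  the partition itself.\<close>

lemma plate_subset_block_weight_imp_eq:
  assumes V: "osp {1..n} V" and W: "osp {1..n} W"
    and sub: "plate n V \<subseteq> dual_halfspace n (block_weight W)" and len: "length V \<le> length W"
  shows "V = W"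
proof -
  have ex: "\<exists>a<length X. i \<in> X ! a" if "osp {1..n} X" "i \<in> {1..n}" for X i
    using osp_Union[OF that(1)] that(2) by (metis UnionE in_set_conv_nth)
  have in_n: "i \<in> {1..n}" if "osp {1..n} X" "a < length X" "i \<in> X ! a" for X a i
    using osp_Union[OF that(1)] nth_mem[OF that(2)] that(3) by blast
  have mono: "a' \<le> b'" if "a \<le> b" "b < length V" "i \<in> V ! a" "j \<in> V ! b"
    "a' < length W" "b' < length W" "i \<in> W ! a'" "j \<in> W ! b'" for a b a' b' i j
  proof -
    let ?x = "\<lambda>k. of_bool (k = i) - of_bool (k = j) :: real"
    have ijn: "i \<in> {1..n}" "j \<in> {1..n}" using in_n[OF W] that by blast+
    have "?x \<in> dual_halfspace n (block_weight W)"
      using sub root_in_plate[OF V that(1-4)] by blast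
    then have "0 \<le> (\<Sum>k=1..n. block_weight W k * ?x k)" by (simp add: dual_halfspace_def)
    also have "\<dots> = block_weight W i - block_weight W j"
    proof -
      have "(\<Sum>k=1..n. block_weight W k * of_bool (k = l)) = block_weight W l" if "l \<in> {1..n}" for l
      proof -
        have "{1..n} \<inter> {k. k = l} = {l}" using that by auto
        then show ?thesis by (simp del: One_nat_def)
      qed
      then show ?thesis using ijn by (simp only: right_diff_distrib sum_subtractf)
    qed
    finally show ?thesis
      using block_weight_nth[OF W that(5,7)] block_weight_nth[OF W that(6,8)] that(5,6) by simp
  qed
  have nonempty: "X ! a \<noteq> {}" if "osp {1..n} X" "a < length X" for X a
    using that(1) nth_mem[OF that(2)] unfolding osp_def partition_on_def by metis
  have "\<exists>b<length W. V ! a \<subseteq> W ! b" if a: "a < length V" for a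
  proof -
    obtain i where i: "i \<in> V ! a" using nonempty[OF V a] by blast
    then obtain b where b: "b < length W" "i \<in> W ! b" using ex[OF W] in_n[OF V a] by blast
    have "j \<in> W ! b" if j: "j \<in> V ! a" for j
    proof -
      obtain b' where b': "b' < length W" "j \<in> W ! b'" using ex[OF W] in_n[OF V a j] by blast
      \<comment> \<open>Elements of one block of \<open>V\<close> are comparable in both directions,
        so they share a block of \<open>W\<close>.\<close>
      have "b = b'"
        using mono[OF order_refl a i j b(1) b'(1) b(2) b'(2)]
          mono[OF order_refl a j i b'(1) b(1) b'(2) b(2)] by simp
      then show ?thesis using b' by simp
    qed
    then show ?thesis using b(1) by blast
  qed
  then obtain \<phi> where \<phi>: "\<And>a. a < length V \<Longrightarrow> \<phi> a < length W" "\<And>a. a < length V \<Longrightarrow> V ! a \<subseteq> W ! \<phi> a"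
    by metis
  have surj: "{..<length W} \<subseteq> \<phi> ` {..<length V}"
  proof
    fix b assume "b \<in> {..<length W}"
    then have b: "b < length W" by simp
    then obtain i where i: "i \<in> W ! b" using nonempty[OF W] by blast
    then obtain a where a: "a < length V" "i \<in> V ! a" using ex[OF V] in_n[OF W b] by blast
    then have "\<phi> a = b" using \<phi>[OF a(1)] osp_nth_unique[OF W _ b _ i] by blast
    then show "b \<in> \<phi> ` {..<length V}" using a(1) by blast
  qed
  then have "card {..<length W} \<le> card (\<phi> ` {..<length V})" by (intro card_mono) auto
  moreover have "card (\<phi> ` {..<length V}) \<le> length V" using card_image_le[of "{..<length V}" \<phi>] by simp
  ultimately have lens: "length V = length W" and inj: "inj_on \<phi> {..<length V}"
    using len by (auto intro: eq_card_imp_inj_on)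
  have "\<phi> a \<le> \<phi> b" if ab: "a \<le> b" and b: "b < length V" for a b
  proof -
    have a: "a < length V" using ab b by simp
    obtain i j where ij: "i \<in> V ! a" "j \<in> V ! b" using nonempty[OF V a] nonempty[OF V b] by blast
    then have "i \<in> W ! \<phi> a" "j \<in> W ! \<phi> b" using \<phi>(2)[OF a] \<phi>(2)[OF b] by auto
    then show ?thesis by (rule mono[OF ab b ij \<phi>(1)[OF a] \<phi>(1)[OF b]])
  qed
  \<comment> \<open>A monotone bijection of an initial segment of the naturals is the
    identity.\<close>
  then have "sorted (map \<phi> [0..<length V])" by (auto simp: sorted_iff_nth_mono)
  moreover have "distinct (map \<phi> [0..<length V])"
    using inj by (simp add: distinct_map atLeast0LessThan)
  moreover have "set (map \<phi> [0..<length V]) = set [0..<length V]"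
    using surj \<phi>(1) lens by (auto simp: atLeast0LessThan)
  ultimately have "map \<phi> [0..<length V] = [0..<length V]"
    by (intro sorted_distinct_set_unique) simp_all
  then have "\<phi> a = a" if "a < length V" for a
    using that by (metis add_0 diff_zero length_upt nth_map nth_upt)
  then have VW: "V ! a \<subseteq> W ! a" if "a < length V" for a using \<phi>(2) that by metis
  show ?thesis
  proof (rule nth_equalityI[OF lens])
    fix a assume a: "a < length V"
    have "i \<in> V ! a" if i: "i \<in> W ! a" for i
    proof -
      obtain b where b: "b < length V" "i \<in> V ! b" using ex[OF V] in_n[OF W _ i] a lens by auto
      then have "a = b" using osp_nth_unique[OF W _ _ i] VW[OF b(1)] a lens by auto
      then show ?thesis using b by simp
    qed
    then show "V ! a = W ! a" using VW[OF a] by blast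
  qed
qed

section \<open>Independence of the graduated blades\<close>

lemma finite_standard_osps: "finite {S. standard_osp {1..n} S}"
proof (rule finite_subset)
  show "{S. standard_osp {1..n} S} \<subseteq> {S. set S \<subseteq> Pow {1..n} \<and> distinct S}"
    by (auto simp: standard_osp_def osp_def partition_on_def)
  show "finite {S. set S \<subseteq> Pow {1..n} \<and> distinct S}" by (rule finite_subset_distinct) simp
qed

text \<open>A proper rotation moves the block with the minimum away from the front.\<close>

lemma rotate_standard_osp_eq:
  assumes "standard_osp U S" "standard_osp U (rotate j S)" "j < length S"
  shows "j = 0"
proof -
  have "hd (rotate j S) = S ! j" using assms(3) by (subst hd_rotate_conv_nth) auto
  then have "Min U \<in> S ! j" "Min U \<in> S ! 0" "osp U S" "0 < length S"
    using assms by (auto simp: standard_osp_def hd_conv_nth)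
  then show ?thesis using osp_nth_unique[of U S j 0] assms(3) by blast
qed

text \<open>Expanded into plates, the relation is dualised at the weight of a longest
  \<open>W\<close> with nonzero coefficient. Among the plates with nonzero coefficient only that of
  \<open>W\<close> lies in this half-space, and it comes from no proper rotation of a standard
  partition.\<close>

lemma blade_coefficients_zero:
  assumes zero: "(\<Sum>S | standard_osp {1..n} S. cscale (c S) (blade n S)) = 0"
    and S: "standard_osp {1..n} S"
  shows "c S = 0"
proof (rule ccontr)
  assume "c S \<noteq> 0"
  define I where "I = {S. standard_osp {1..n} S}"
  have finI: "finite I" unfolding I_def by (rule finite_standard_osps)
  define J where "J = {S \<in> I. c S \<noteq> 0}"
  have "finite J" "J \<noteq> {}" using finI S \<open>c S \<noteq> 0\<close> by (auto simp: J_def I_def)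
  then obtain W where W: "W \<in> J" "\<And>V. V \<in> J \<Longrightarrow> length V \<le> length W"
    using Max_in[of "length ` J"] Max_ge[of "length ` J"] by (metis (no_types, lifting) finite_imageI imageE image_eqI image_is_empty)
  have ospI: "osp {1..n} S" if "S \<in> I" for S using that by (simp add: I_def standard_osp_def)
  have WI: "W \<in> I" "c W \<noteq> 0" using W(1) by (auto simp: J_def)
  let ?X = "SIGMA S:I. {..<length S}"
  let ?D = "dual_halfspace n (block_weight W)"
  have "(\<Sum>S\<in>I. cscale (c S) (blade n S))
      = (\<Sum>S\<in>I. \<Sum>j<length S. cscale (c S) (char_fun (plate n (rotate j S))))"
    by (simp only: blade_def cfun.scale_sum_right)
  also have "\<dots> = (\<Sum>(S, j)\<in>?X. cscale (c S) (char_fun (plate n (rotate j S))))"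
    using finI by (intro sum.Sigma) auto
  finally have rel: "(\<Sum>p\<in>?X. cscale (c (fst p)) (char_fun (plate n (rotate (snd p) (fst p))))) = 0"
    using zero by (simp add: I_def case_prod_unfold)
  have "(\<Sum>p\<in>?X. c (fst p) * of_bool (plate n (rotate (snd p) (fst p)) \<subseteq> ?D)) = 0"
    by (rule dual_relation[OF _ rel]) (auto intro!: polyhedral_cone_plate[OF osp_rotate] dest: ospI)
  moreover have "(\<Sum>p\<in>?X. c (fst p) * of_bool (plate n (rotate (snd p) (fst p)) \<subseteq> ?D))
      = (\<Sum>p\<in>{(W, 0)}. c (fst p) * of_bool (plate n (rotate (snd p) (fst p)) \<subseteq> ?D))"
  proof (rule sum.mono_neutral_right)
    show "finite ?X" using finI by auto
    show "{(W, 0)} \<subseteq> ?X" using WI by (auto simp: I_def standard_osp_def)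
    show "\<forall>p\<in>?X - {(W, 0)}. c (fst p) * of_bool (plate n (rotate (snd p) (fst p)) \<subseteq> ?D) = 0"
    proof
      fix p assume p: "p \<in> ?X - {(W, 0)}"
      obtain S j where Sj: "p = (S, j)" "S \<in> I" "j < length S" using p by auto
      \<comment> \<open>The length bound needed for the comparison with \<open>W\<close> is
        available only for nonzero coefficients, hence the argument by contradiction.\<close>
      have "c S = 0" if "plate n (rotate j S) \<subseteq> ?D"
      proof (rule ccontr)
        assume "c S \<noteq> 0"
        then have "length (rotate j S) \<le> length W" using W(2) Sj(2) by (simp add: J_def)
        then have eq: "rotate j S = W"
          by (rule plate_subset_block_weight_imp_eq[OF osp_rotate[OF ospI[OF Sj(2)]] ospI[OF WI(1)] that])
        then have "j = 0" using rotate_standard_osp_eq[of "{1..n}" S j] Sj WI(1) by (simp add: I_def)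
        then show False using eq Sj(1) p by simp
      qed
      then show "c (fst p) * of_bool (plate n (rotate (snd p) (fst p)) \<subseteq> ?D) = 0"
        by (auto simp: Sj(1))
    qed
  qed
  ultimately show False
    using WI plate_subset_block_weight[OF ospI[OF WI(1)]] by simp
qed

lemma
  shows inj_on_blade: "inj_on (blade n) {S. standard_osp {1..n} S}"
    and independent_blades: "cfun.independent (blade n ` {S. standard_osp {1..n} S})"
proof -
  let ?I = "{S. standard_osp {1..n} S}"
  show inj: "inj_on (blade n) ?I"
  proof (rule inj_onI, rule ccontr)
    fix S S' assume *: "S \<in> ?I" "S' \<in> ?I" "blade n S = blade n S'" "S \<noteq> S'"
    define c :: "nat set list \<Rightarrow> complex" where "c X = of_bool (X = S) - of_bool (X = S')" for X
    have "(\<Sum>X\<in>?I. cscale (c X) (blade n X)) = (\<Sum>X\<in>{S, S'}. cscale (c X) (blade n X))"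
      using * finite_standard_osps[of n] by (intro sum.mono_neutral_right) (auto simp: c_def)
    also have "\<dots> = 0" using * by (simp add: c_def cfun.scale_minus_left)
    finally have "c S = 0" using * by (intro blade_coefficients_zero) auto
    then show False using * by (simp add: c_def)
  qed
  show "cfun.independent (blade n ` ?I)"
  proof (rule cfun.independent_if_scalars_zero)
    show "finite (blade n ` ?I)" using finite_standard_osps by simp
    fix f x assume f: "(\<Sum>x\<in>blade n ` ?I. cscale (f x) x) = 0" and "x \<in> blade n ` ?I"
    then obtain S where S: "x = blade n S" "standard_osp {1..n} S" by blast
    have "(\<Sum>S\<in>?I. cscale (f (blade n S)) (blade n S)) = 0"
      using f sum.reindex[OF inj, of "\<lambda>x. cscale (f x) x"] by (simp only: o_def)
    then show "f x = 0" using blade_coefficients_zero[of "\<lambda>S. f (blade n S)"] S by blast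
  qed
qed

text \<open>Keys are only partially ordered and may coincide, so the recursion expressing
  \<open>b i\<close> through \<open>u\<close> runs on the number of indices with smaller key.
  Independence is a count: the \<open>u i\<close> span a space of dimension \<open>card I\<close>,
  so none of them can be redundant.\<close>

lemma unitriangular_basis:
  fixes b u :: "'i \<Rightarrow> cfun" and key :: "'i \<Rightarrow> 'k::order"
  assumes fin: "finite I" and inj: "inj_on b I" and ind: "cfun.independent (b ` I)"
    and tri: "\<And>i. i \<in> I \<Longrightarrow> u i - b i \<in> cfun.span {b j |j. j \<in> I \<and> key j < key i}"
  shows "cfun.span (u ` I) = cfun.span (b ` I)" "inj_on u I" "cfun.independent (u ` I)"
proof -
  have bu: "b i \<in> cfun.span (u ` I)" if "i \<in> I" for i
    using that
  proof (induction "card {j \<in> I. key j < key i}" arbitrary: i rule: less_induct)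
    case less
    have "{b j |j. j \<in> I \<and> key j < key i} \<subseteq> cfun.span (u ` I)"
    proof clarify
      fix j assume j: "j \<in> I" "key j < key i"
      then have "{k \<in> I. key k < key j} \<subset> {k \<in> I. key k < key i}" by force
      then have "card {k \<in> I. key k < key j} < card {k \<in> I. key k < key i}"
        using fin by (intro psubset_card_mono) auto
      then show "b j \<in> cfun.span (u ` I)" using less.hyps j(1) by blast
    qed
    then have diff: "u i - b i \<in> cfun.span (u ` I)"
      using tri[OF less.prems] cfun.span_minimal[OF _ cfun.subspace_span] by blast
    have "u i \<in> cfun.span (u ` I)" using less.prems by (intro cfun.span_base) simp
    then have "u i - (u i - b i) \<in> cfun.span (u ` I)" using diff by (rule cfun.span_diff)
    then show ?case by (simp only: diff_diff_eq2 add_diff_cancel_left')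
  qed
  have ub: "u i \<in> cfun.span (b ` I)" if "i \<in> I" for i
  proof -
    have "{b j |j. j \<in> I \<and> key j < key i} \<subseteq> b ` I" by blast
    then have "u i - b i \<in> cfun.span (b ` I)" using tri[OF that] cfun.span_mono by blast
    moreover have "b i \<in> cfun.span (b ` I)" using that by (intro cfun.span_base) simp
    ultimately have "u i - b i + b i \<in> cfun.span (b ` I)" by (intro cfun.span_add)
    then show ?thesis by (simp only: diff_add_cancel)
  qed
  show span: "cfun.span (u ` I) = cfun.span (b ` I)"
    using bu ub by (intro cfun.span_eq[THEN iffD2]) auto
  have card: "card I \<le> card X" if "finite X" "cfun.span X = cfun.span (u ` I)" for X
  proof -
    have "b ` I \<subseteq> cfun.span X" using that(2) bu by auto
    then have "card (b ` I) \<le> card X" using cfun.independent_span_bound[OF that(1) ind] by blast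
    then show ?thesis by (simp add: card_image[OF inj])
  qed
  have "card (u ` I) = card I"
    using card[of "u ` I"] fin card_image_le[OF fin, of u] by simp
  then show "inj_on u I" using fin by (intro eq_card_imp_inj_on)
  show "cfun.independent (u ` I)"
  proof
    assume "cfun.dependent (u ` I)"
    then obtain a where a: "a \<in> u ` I" "a \<in> cfun.span (u ` I - {a})"
      unfolding cfun.dependent_def by blast
    have "cfun.span (u ` I - {a}) = cfun.span (u ` I)"
      using cfun.span_redundant[OF a(2)] a(1) by (simp add: insert_absorb)
    then have "card I \<le> card (u ` I - {a})" using fin by (intro card) auto
    also have "\<dots> < card (u ` I)" using fin a(1) by (intro psubset_card_mono) auto
    finally show False using \<open>card (u ` I) = card I\<close> by simp
  qed
qed

theorem theorem35:
  fixes n :: nat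
  assumes "n \<ge> 1"
  shows "(\<exists>\<phi>. U_B_endo n \<phi>) \<and>
    (\<forall>\<phi>. U_B_endo n \<phi> \<longrightarrow> bij_betw \<phi> (blade_space n) (blade_space n)) \<and>
    inj_on (composite_fun n) {C. composite_osp n C} \<and>
    cfun.independent (composite_fun n ` {C. composite_osp n C}) \<and>
    cfun.span (composite_fun n ` {C. composite_osp n C}) = blade_space n"
proof -
  define I where "I = {S. standard_osp {1..n} S}"
  define u where "u S = composite_fun n (U_B S)" for S
  have inj: "inj_on (blade n) I" and ind: "cfun.independent (blade n ` I)"
    unfolding I_def by (rule inj_on_blade independent_blades)+
  have space: "blade_space n = cfun.span (blade n ` I)"
    by (simp only: blade_space_def I_def image_Collect)
  have tri: "u S - blade n S \<in> cfun.span {blade n S' |S'. S' \<in> I \<and> min_word S' < min_word S}"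
    if "S \<in> I" for S
    using composite_fun_U_B[OF _ assms, of S] that by (simp add: u_def I_def)
  have fin: "finite I" unfolding I_def by (rule finite_standard_osps)
  note u = unitriangular_basis[of I "blade n" u min_word, OF fin inj ind tri]
  have comps: "{C. composite_osp n C} = U_B ` I"
    using composite_osp_U_B[OF _ assms] composite_osp_cases[OF _ assms] by (force simp: I_def)
  have image: "composite_fun n ` {C. composite_osp n C} = u ` I"
    by (simp add: comps image_image u_def)
  have inj_comp: "inj_on (composite_fun n) {C. composite_osp n C}"
  proof -
    \<comment> \<open>Every composite is a value of \<open>U_B\<close>, so injectivity of the
      composition on \<open>I\<close> gives injectivity of \<open>composite_fun n\<close> on
      composites.\<close>
    have "inj_on (composite_fun n \<circ> U_B) I" using u(2) by (simp add: inj_on_def u_def)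
    then show ?thesis unfolding comps by (rule inj_on_imageI)
  qed
  \<comment> \<open>A linear map on all functions whose restriction to \<open>blade_space n\<close>
    is the required endomorphism; it sends a basis bijectively to a basis.\<close>
  obtain \<psi> where \<psi>: "Vector_Spaces.linear cscale cscale \<psi>"
    "\<And>x. x \<in> blade n ` I \<Longrightarrow> \<psi> x = u (inv_into I (blade n) x)"
    using cfun_pair.linear_independent_extend[OF ind, of "\<lambda>x. u (inv_into I (blade n) x)"] by blast
  have \<psi>u: "\<psi> (blade n S) = u S" if "S \<in> I" for S
    using \<psi>(2) that inj by simp
  then have \<psi>_image: "\<psi> ` blade n ` I = u ` I" by (auto simp: image_image)
  have \<psi>_space: "\<psi> ` blade_space n = blade_space n"
    unfolding space cfun_pair.linear_span_image[OF \<psi>(1), symmetric] \<psi>_image by (rule u(1))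
  have \<psi>_basis: "inj_on \<psi> (blade n ` I)"
    by (rule inj_on_imageI) (use u(2) in \<open>simp add: inj_on_def \<psi>u\<close>)
  have "cfun.independent (\<psi> ` blade n ` I)" unfolding \<psi>_image by (rule u(3))
  then have \<psi>_inj: "inj_on \<psi> (blade_space n)"
    unfolding space using \<psi>_basis by (rule cfun_pair.linear_inj_on_span_independent_image[OF \<psi>(1)])
  have "U_B_endo n \<psi>"
    unfolding U_B_endo_def linear_endo_on_def
    using \<psi>_space \<psi>u cfun_pair.linear_add[OF \<psi>(1)] cfun_pair.linear_scale[OF \<psi>(1)]
    by (auto simp: u_def I_def)
  \<comment> \<open>An arbitrary \<open>\<phi>\<close> is constrained on
    \<open>blade_space n\<close> only; there it agrees with \<open>\<psi>\<close> by linearity and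
    inherits bijectivity.\<close>
  moreover have "bij_betw \<phi> (blade_space n) (blade_space n)" if \<phi>: "U_B_endo n \<phi>" for \<phi>
  proof -
    have zero: "0 \<in> blade_space n" unfolding space by (rule cfun.span_zero)
    have lin: "\<And>f g. f \<in> blade_space n \<Longrightarrow> g \<in> blade_space n \<Longrightarrow> \<phi> (f + g) = \<phi> f + \<phi> g"
      "\<And>c f. f \<in> blade_space n \<Longrightarrow> \<phi> (cscale c f) = cscale c (\<phi> f)"
      using \<phi> unfolding U_B_endo_def linear_endo_on_def by blast+
    have "f \<in> blade_space n \<and> \<phi> f = \<psi> f" if "f \<in> blade_space n" for f
      using that[unfolded space]
    proof (rule cfun.span_induct_alt)
      have "\<phi> 0 = 0" using lin(2)[OF zero, of 0] by simp
      then show "0 \<in> blade_space n \<and> \<phi> 0 = \<psi> 0"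
        using zero cfun_pair.linear_0[OF \<psi>(1)] by simp
    next
      fix c x y assume "x \<in> blade n ` I" and y: "y \<in> blade_space n \<and> \<phi> y = \<psi> y"
      then obtain S where S: "x = blade n S" "S \<in> I" by blast
      have x: "x \<in> blade_space n" unfolding space S(1) using S(2) by (intro cfun.span_base) simp
      have cx: "cscale c x \<in> blade_space n" using x unfolding space by (rule cfun.span_scale)
      have "\<phi> x = \<psi> x" using \<phi> S \<psi>u by (simp add: U_B_endo_def I_def u_def)
      then have "\<phi> (cscale c x + y) = \<psi> (cscale c x + y)"
        using lin(1)[OF cx] lin(2)[OF x] y
        by (simp only: cfun_pair.linear_add[OF \<psi>(1)] cfun_pair.linear_scale[OF \<psi>(1)])
      moreover have "cscale c x + y \<in> blade_space n"
        using cx y unfolding space by (intro cfun.span_add) auto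
      ultimately show "cscale c x + y \<in> blade_space n \<and> \<phi> (cscale c x + y) = \<psi> (cscale c x + y)" by blast
    qed
    then have "bij_betw \<phi> (blade_space n) (blade_space n) \<longleftrightarrow> bij_betw \<psi> (blade_space n) (blade_space n)"
      by (intro bij_betw_cong) blast
    then show ?thesis using \<psi>_inj \<psi>_space by (simp add: bij_betw_def)
  qed
  ultimately show ?thesis
    using inj_comp u(1,3) unfolding image space by blast
qed

end
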